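(* Let $(A,\star,\succ,\prec,P,Q)$ be a relative pre-PCA algebra and $(A,\cdot,\circ,P,Q)$ be the sub-adjacent relative PCA algebra. Let $\{e_{1},\cdots,e_{n}\}$ be a basis of $A$ and $\{e^{*}_{1},\cdots,e^{*}_{n}\}$ be the dual basis of $A^*$. Then $$r=\sum_{i=1}^{n}(e^{*}_{i}\otimes e_{i}-e_{i}\otimes e^{*}_{i})$$ is an antisymmetric solution of the RPCA-YBE in the relative PCA algebra $(A\ltimes_{-\mathcal{L}_{\star}^{*},\mathcal{R}^{*}_{\prec}-\mathcal{L}^{*}_{\succ},\mathcal{R}^{*}_{\prec}}A^{*},P+Q^{*},Q+P^{*})$, i.e. $A\oplus A^*$ with the linear maps $P+Q^*$, $Q+P^*$ and the operations $$(x+a^* )\cdot(y+b^* )=x\cdot y-\mathcal{L}_\star^*(x)b^*-\mathcal{L}_\star^*(y)a^*,\qquad (x+a^* )\circ(y+b^* )=x\circ y+(\mathcal{R}_\prec^*-\mathcal{L}_\succ^* )(x)b^*+\mathcal{R}_\prec^*(y)a^*.$$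
   Context: All vector spaces are finite-dimensional over an algebraically closed field $\mathbb K$ of characteristic zero. $\mathcal{L}_{\diamond}(x)y=x\diamond y$, $\mathcal{R}_{\diamond}(x)y=y\diamond x$. For $f:A\rightarrow \mathrm{End}_{\mathbb K}(V)$, $f^{*}:A\rightarrow\mathrm{End}_{\mathbb K}(V^{*})$ is defined by $\langle f^{*}(x)u^{*},v\rangle=-\langle u^{*},f(x)v\rangle$; $P^*,Q^*$ are transposes (no sign). $r$ is antisymmetric if $\tau(r)=-r$, $\tau(X\otimes Y)=Y\otimes X$. Zinbiel algebra: $(A,\star)$ with $x\star(y\star z)=(y\star x)\star z+(x\star y)\star z$. Pre-APL algebra: $(A,\succ,\prec)$ such that for all $x,y,z$: $x\succ(y\succ z)-y\succ(x\succ z)=(y\succ x+y\prec x)\succ z-(x\succ y+x\prec y)\succ z$; $z\prec(x\succ y+x\prec y)=x\succ(z\prec y)+(x\succ z)\prec y-(z\prec x)\prec y$; $x\succ(y\succ z)-y\succ(x\succ z)=(y\succ z)\prec x-(x\succ z)\prec y-(z\prec y)\prec x+(z\prec x)\prec y$. Pre-Lie algebra: $(x\diamond y)\diamond z-x\diamond(y\diamond z)=(y\diamond x)\diamond z-y\diamond(x\diamond z)$. Relative pre-Poisson algebra: $(A,\star,\diamond,P)$ with $(A,\star)$ a Zinbiel algebra, $(A,\diamond)$ a pre-Lie algebra, $P$ a derivation of both, and $y\diamond(x\star z)-x\star(y\diamond z)+(x\diamond y-y\diamond x)\star z-(x\star P(y)+P(y)\star x)\star z=0$, $(x\star y+y\star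 x)\diamond z-x\star(y\diamond z)-y\star(x\diamond z)+(x\star y+y\star x)\star P(z)=0$. Relative pre-PCA algebra: $(A,\star,\succ,\prec,P,Q)$ where $(A,\star)$ is a Zinbiel algebra, $(A,\succ,\prec)$ is a pre-APL algebra, $P,Q:A\to A$ are linear, and, with $x\cdot y=x\star y+y\star x$, $x\circ y=x\succ y+x\prec y$, $x\diamond y=x\succ y-y\prec x$, $[x,y]=x\circ y-y\circ x$: $(A,\star,\diamond,P)$ is a relative pre-Poisson algebra; $Q(x)\star y-x\star P(y)-Q(x\star y)=0$ and $x\star Q(y)-P(x)\star y-Q(x\star y)=0$; and for all $x,y,z\in A$: $y\prec Q(x)-P(y)\prec x-Q(y\prec x)=0$; $x\succ Q(y)-P(x)\succ y-Q(x\succ y)=0$; $(y\circ x)\star z-y\succ(x\star z)-x\star(y\diamond z)-(x\cdot P(y))\star z=0$; $x\star(z\prec y)-z\prec(x\cdot y)+y\star(x\diamond z)-(x\cdot y)\star P(z)=0$; $x\star(y\succ z)-y\succ(x\star z)+[x,y]\star z-(x\cdot P(y))\star z=0$; $(y\star z)\prec x-y\succ(x\star z)-z\prec(x\cdot y)+Q((x\cdot y)\star z)=0$; $(x\cdot y)\succ z-y\succ(x\star z)-x\succ(y\star z)+Q((x\cdot y)\star z)=0$. The sub-adjacent relative PCA algebra is $(A,\cdot,\circ,P,Q)$ with these $\cdot$ and $\circ$. It is known to be a relative PCA algebra, and the structure on $A\oplus A^*$ in the claim is also a relative PCA algebra. Relative PCA algebra: $(A,\cdot,\circ,P,Q)$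 with $(A,\cdot)$ commutative associative; $(A,\circ)$ anti-pre-Lie, i.e. with $[x,y]=x\circ y-y\circ x$, $x\circ(y\circ z)-y\circ(x\circ z)=[y,x]\circ z$ and $[x,y]\circ z+[y,z]\circ x+[z,x]\circ y=0$ (so $[-,-]$ is a Lie bracket); $P,Q$ linear; $P$ a derivation of $(A,\cdot)$ and $(A,[-,-])$; $[z,x\cdot y]=[z,x]\cdot y+x\cdot[z,y]+x\cdot y\cdot P(z)$; and: $x\cdot Q(y)-P(x)\cdot y-Q(x\cdot y)=0$; $x\circ Q(y)-P(x)\circ y-Q(x\circ y)=0$; $x\cdot(y\circ z)-y\circ(x\cdot z)+[x,y]\cdot z-x\cdot P(y)\cdot z=0$; $(x\cdot y)\circ z-y\circ(x\cdot z)-x\circ(y\cdot z)+Q(x\cdot y\cdot z)=0$ for all $x,y,z$. RPCA-YBE (relative PCA Yang-Baxter equation) in a relative PCA algebra $(A,\cdot,\circ,P,Q)$: for $r=\sum_i a_i\otimes b_i\in A\otimes A$ put $\mathbf{A}(r)=\sum_{i,j}\big(a_i\cdot a_j\otimes b_i\otimes b_j-a_i\otimes a_j\cdot b_i\otimes b_j+a_i\otimes a_j\otimes b_i\cdot b_j\big)$, $\mathbf{T}(r)=\sum_{i,j}\big(a_i\circ a_j\otimes b_i\otimes b_j+a_i\otimes b_i\circ a_j\otimes b_j-a_i\otimes a_j\otimes[b_i,b_j]\big)$. $r$ is a solution if $\mathbf{A}(r)=\mathbf{T}(r)=0$, $(Q\otimes\mathrm{id}-\mathrm{id}\otimes P)r=0$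 and $(P\otimes\mathrm{id}-\mathrm{id}\otimes Q)r=0$. (In the claim, $P,Q$ are replaced by $P+Q^*$, $Q+P^*$.) *)

theory Defs
  imports
    "HOL-Computational_Algebra.Polynomial"
    "HOL-Library.Function_Algebras"
    "HOL-Library.Product_Plus"
    "HOL-Library.Poly_Mapping"
begin

section \<open>Relative pre-PCA algebras\<close>

definition bilinear_op ::
  "('k::field \<Rightarrow> 'a::ab_group_add \<Rightarrow> 'a) \<Rightarrow> ('a \<Rightarrow> 'a \<Rightarrow> 'a) \<Rightarrow> bool" where
  "bilinear_op scale m \<longleftrightarrow>
     (\<forall>x. Vector_Spaces.linear scale scale (m x)) \<and>
     (\<forall>y. Vector_Spaces.linear scale scale (\<lambda>x. m x y))"

locale zinbiel_algebra = vector_space scale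
  for scale :: "'k::field \<Rightarrow> 'a::ab_group_add \<Rightarrow> 'a" +
  fixes star :: "'a \<Rightarrow> 'a \<Rightarrow> 'a" (infixl "\<star>" 70)
  assumes star_bilinear: "bilinear_op scale (\<star>)"
    and zinbiel: "x \<star> (y \<star> z) = (y \<star> x) \<star> z + (x \<star> y) \<star> z"

locale pre_lie_algebra = vector_space scale
  for scale :: "'k::field \<Rightarrow> 'a::ab_group_add \<Rightarrow> 'a" +
  fixes diamond :: "'a \<Rightarrow> 'a \<Rightarrow> 'a" (infixl "\<diamondop>" 70)
  assumes diamond_bilinear: "bilinear_op scale (\<diamondop>)"
    and pre_lie: "(x \<diamondop> y) \<diamondop> z - x \<diamondop> (y \<diamondop> z) = (y \<diamondop> x) \<diamondop> z - y \<diamondop> (x \<diamondop> z)"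

locale pre_APL_algebra = vector_space scale
  for scale :: "'k::field \<Rightarrow> 'a::ab_group_add \<Rightarrow> 'a" +
  fixes succ :: "'a \<Rightarrow> 'a \<Rightarrow> 'a" (infixl "\<succ>" 70)
    and prec :: "'a \<Rightarrow> 'a \<Rightarrow> 'a" (infixl "\<prec>" 70)
  assumes succ_bilinear: "bilinear_op scale (\<succ>)"
    and prec_bilinear: "bilinear_op scale (\<prec>)"
    and pre_APL_1: "x \<succ> (y \<succ> z) - y \<succ> (x \<succ> z)
          = (y \<succ> x + y \<prec> x) \<succ> z - (x \<succ> y + x \<prec> y) \<succ> z"
    and pre_APL_2: "z \<prec> (x \<succ> y + x \<prec> y) = x \<succ> (z \<prec> y) + (x \<succ> z) \<prec> y - (z \<prec> x) \<prec> y"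
    and pre_APL_3: "x \<succ> (y \<succ> z) - y \<succ> (x \<succ> z)
          = (y \<succ> z) \<prec> x - (x \<succ> z) \<prec> y - (z \<prec> y) \<prec> x + (z \<prec> x) \<prec> y"

locale relative_pre_poisson_algebra =
  zinbiel_algebra scale star + pre_lie_algebra scale diamond
  for scale :: "'k::field \<Rightarrow> 'a::ab_group_add \<Rightarrow> 'a"
    and star :: "'a \<Rightarrow> 'a \<Rightarrow> 'a" (infixl "\<star>" 70)
    and diamond :: "'a \<Rightarrow> 'a \<Rightarrow> 'a" (infixl "\<diamondop>" 70) +
  fixes P :: "'a \<Rightarrow> 'a"
  assumes P_linear: "Vector_Spaces.linear scale scale P"
    and P_star: "P (x \<star> y) = P x \<star> y + x \<star> P y"
    and P_diamond: "P (x \<diamondop> y) = P x \<diamondop> y + x \<diamondop> P y"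
    and pre_poisson_1: "y \<diamondop> (x \<star> z) - x \<star> (y \<diamondop> z) + (x \<diamondop> y - y \<diamondop> x) \<star> z
          - (x \<star> P y + P y \<star> x) \<star> z = 0"
    and pre_poisson_2: "(x \<star> y + y \<star> x) \<diamondop> z - x \<star> (y \<diamondop> z) - y \<star> (x \<diamondop> z)
          + (x \<star> y + y \<star> x) \<star> P z = 0"

definition sub_dot :: "('a \<Rightarrow> 'a \<Rightarrow> 'a) \<Rightarrow> 'a \<Rightarrow> 'a \<Rightarrow> 'a::ab_group_add" where
  "sub_dot star x y = star x y + star y x"

definition sub_circ ::
  "('a \<Rightarrow> 'a \<Rightarrow> 'a) \<Rightarrow> ('a \<Rightarrow> 'a \<Rightarrow> 'a) \<Rightarrow> 'a \<Rightarrow> 'a \<Rightarrow> 'a::ab_group_add" where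
  "sub_circ succ prec x y = succ x y + prec x y"

definition sub_diamond ::
  "('a \<Rightarrow> 'a \<Rightarrow> 'a) \<Rightarrow> ('a \<Rightarrow> 'a \<Rightarrow> 'a) \<Rightarrow> 'a \<Rightarrow> 'a \<Rightarrow> 'a::ab_group_add" where
  "sub_diamond succ prec x y = succ x y - prec y x"

definition commutator :: "('a \<Rightarrow> 'a \<Rightarrow> 'a) \<Rightarrow> 'a \<Rightarrow> 'a \<Rightarrow> 'a::ab_group_add" where
  "commutator circ x y = circ x y - circ y x"

locale pre_PCA_operations =
  zinbiel_algebra scale star + pre_APL_algebra scale succ prec
  for scale :: "'k::field \<Rightarrow> 'a::ab_group_add \<Rightarrow> 'a"
    and star :: "'a \<Rightarrow> 'a \<Rightarrow> 'a" (infixl "\<star>" 70)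
    and succ :: "'a \<Rightarrow> 'a \<Rightarrow> 'a" (infixl "\<succ>" 70)
    and prec :: "'a \<Rightarrow> 'a \<Rightarrow> 'a" (infixl "\<prec>" 70)
begin

abbreviation dot (infixl "\<cdot>" 70) where "x \<cdot> y \<equiv> sub_dot (\<star>) x y"
abbreviation circ (infixl "\<odot>" 70) where "x \<odot> y \<equiv> sub_circ (\<succ>) (\<prec>) x y"
abbreviation diamond (infixl "\<diamondop>" 70) where "x \<diamondop> y \<equiv> sub_diamond (\<succ>) (\<prec>) x y"
abbreviation bracket where "bracket x y \<equiv> commutator (sub_circ (\<succ>) (\<prec>)) x y"

end

locale relative_pre_PCA_algebra =
  pre_PCA_operations scale star succ prec +
  relative_pre_poisson_algebra scale star "sub_diamond succ prec" P
  for scale :: "'k::field \<Rightarrow> 'a::ab_group_add \<Rightarrow> 'a"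
    and star :: "'a \<Rightarrow> 'a \<Rightarrow> 'a" (infixl "\<star>" 70)
    and succ :: "'a \<Rightarrow> 'a \<Rightarrow> 'a" (infixl "\<succ>" 70)
    and prec :: "'a \<Rightarrow> 'a \<Rightarrow> 'a" (infixl "\<prec>" 70)
    and P :: "'a \<Rightarrow> 'a" +
  fixes Q :: "'a \<Rightarrow> 'a"
  assumes Q_linear: "Vector_Spaces.linear scale scale Q"
    and Q_star_left: "Q x \<star> y - x \<star> P y - Q (x \<star> y) = 0"
    and Q_star_right: "x \<star> Q y - P x \<star> y - Q (x \<star> y) = 0"
    and Q_prec: "y \<prec> Q x - P y \<prec> x - Q (y \<prec> x) = 0"
    and Q_succ: "x \<succ> Q y - P x \<succ> y - Q (x \<succ> y) = 0"
    and pre_PCA_1: "(y \<odot> x) \<star> z - y \<succ> (x \<star> z) - x \<star> (y \<diamondop> z) - (x \<cdot> P y) \<star> z = 0"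
    and pre_PCA_2: "x \<star> (z \<prec> y) - z \<prec> (x \<cdot> y) + y \<star> (x \<diamondop> z) - (x \<cdot> y) \<star> P z = 0"
    and pre_PCA_3: "x \<star> (y \<succ> z) - y \<succ> (x \<star> z) + bracket x y \<star> z - (x \<cdot> P y) \<star> z = 0"
    and pre_PCA_4: "(y \<star> z) \<prec> x - y \<succ> (x \<star> z) - z \<prec> (x \<cdot> y) + Q ((x \<cdot> y) \<star> z) = 0"
    and pre_PCA_5: "(x \<cdot> y) \<succ> z - y \<succ> (x \<star> z) - x \<succ> (y \<star> z) + Q ((x \<cdot> y) \<star> z) = 0"


section \<open>Relative PCA algebras\<close>

text \<open>
  These are carried by a subspace \<open>V\<close> of an ambient vector space, because the dual space
  of \<open>A\<close> is a proper subspace of the function type \<open>'a \<Rightarrow> 'k\<close>.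
\<close>

definition linear_on ::
  "('k \<Rightarrow> 'v \<Rightarrow> 'v) \<Rightarrow> 'v set \<Rightarrow> ('v \<Rightarrow> 'v::ab_group_add) \<Rightarrow> bool" where
  "linear_on scale V f \<longleftrightarrow>
     (\<forall>x\<in>V. f x \<in> V) \<and>
     (\<forall>x\<in>V. \<forall>y\<in>V. f (x + y) = f x + f y) \<and>
     (\<forall>c. \<forall>x\<in>V. f (scale c x) = scale c (f x))"

definition bilinear_on ::
  "('k \<Rightarrow> 'v \<Rightarrow> 'v) \<Rightarrow> 'v set \<Rightarrow> ('v \<Rightarrow> 'v \<Rightarrow> 'v::ab_group_add) \<Rightarrow> bool" where
  "bilinear_on scale V m \<longleftrightarrow>
     (\<forall>x\<in>V. linear_on scale V (m x)) \<and> (\<forall>y\<in>V. linear_on scale V (\<lambda>x. m x y))"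

locale PCA_operations = vector_space scale
  for scale :: "'k::field \<Rightarrow> 'v::ab_group_add \<Rightarrow> 'v" +
  fixes V :: "'v set"
    and dot :: "'v \<Rightarrow> 'v \<Rightarrow> 'v" (infixl "\<cdot>" 70)
    and circ :: "'v \<Rightarrow> 'v \<Rightarrow> 'v" (infixl "\<odot>" 70)
  assumes V_subspace: "subspace V"
    and V_finite_dimensional: "\<exists>B. finite B \<and> span B = V"
    and dot_bilinear: "bilinear_on scale V (\<cdot>)"
    and circ_bilinear: "bilinear_on scale V (\<odot>)"
begin

abbreviation bracket where "bracket x y \<equiv> commutator (\<odot>) x y"

end

locale relative_PCA_algebra = PCA_operations scale V dot circ
  for scale :: "'k::field \<Rightarrow> 'v::ab_group_add \<Rightarrow> 'v"
    and V :: "'v set"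
    and dot :: "'v \<Rightarrow> 'v \<Rightarrow> 'v" (infixl "\<cdot>" 70)
    and circ :: "'v \<Rightarrow> 'v \<Rightarrow> 'v" (infixl "\<odot>" 70) +
  fixes P Q :: "'v \<Rightarrow> 'v"
  assumes P_linear: "linear_on scale V P"
    and Q_linear: "linear_on scale V Q"
    and dot_commute: "\<lbrakk>x \<in> V; y \<in> V\<rbrakk> \<Longrightarrow> x \<cdot> y = y \<cdot> x"
    and dot_assoc: "\<lbrakk>x \<in> V; y \<in> V; z \<in> V\<rbrakk> \<Longrightarrow> (x \<cdot> y) \<cdot> z = x \<cdot> (y \<cdot> z)"
    and anti_pre_lie_1: "\<lbrakk>x \<in> V; y \<in> V; z \<in> V\<rbrakk> \<Longrightarrow>
          x \<odot> (y \<odot> z) - y \<odot> (x \<odot> z) = bracket y x \<odot> z"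
    and anti_pre_lie_2: "\<lbrakk>x \<in> V; y \<in> V; z \<in> V\<rbrakk> \<Longrightarrow>
          bracket x y \<odot> z + bracket y z \<odot> x + bracket z x \<odot> y = 0"
    and P_dot: "\<lbrakk>x \<in> V; y \<in> V\<rbrakk> \<Longrightarrow> P (x \<cdot> y) = P x \<cdot> y + x \<cdot> P y"
    and P_bracket: "\<lbrakk>x \<in> V; y \<in> V\<rbrakk> \<Longrightarrow>
          P (bracket x y) = bracket (P x) y + bracket x (P y)"
    and bracket_dot: "\<lbrakk>x \<in> V; y \<in> V; z \<in> V\<rbrakk> \<Longrightarrow>
          bracket z (x \<cdot> y) = bracket z x \<cdot> y + x \<cdot> bracket z y + x \<cdot> y \<cdot> P z"
    and Q_dot: "\<lbrakk>x \<in> V; y \<in> V\<rbrakk> \<Longrightarrow> x \<cdot> Q y - P x \<cdot> y - Q (x \<cdot> y) = 0"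
    and Q_circ: "\<lbrakk>x \<in> V; y \<in> V\<rbrakk> \<Longrightarrow> x \<odot> Q y - P x \<odot> y - Q (x \<odot> y) = 0"
    and PCA_1: "\<lbrakk>x \<in> V; y \<in> V; z \<in> V\<rbrakk> \<Longrightarrow>
          x \<cdot> (y \<odot> z) - y \<odot> (x \<cdot> z) + bracket x y \<cdot> z - x \<cdot> P y \<cdot> z = 0"
    and PCA_2: "\<lbrakk>x \<in> V; y \<in> V; z \<in> V\<rbrakk> \<Longrightarrow>
          (x \<cdot> y) \<odot> z - y \<odot> (x \<cdot> z) - x \<odot> (y \<cdot> z) + Q (x \<cdot> y \<cdot> z) = 0"


section \<open>The semi-direct product on \<open>A \<oplus> A\<^sup>*\<close>\<close>

definition dual_space :: "('k::field \<Rightarrow> 'a::ab_group_add \<Rightarrow> 'a) \<Rightarrow> ('a \<Rightarrow> 'k) set" where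
  "dual_space scale = {u. Vector_Spaces.linear scale (*) u}"

text \<open>The map \<open>f\<^sup>*\<close> of a map \<open>f\<close> from \<open>A\<close> to its endomorphisms carries a sign; the transpose does not.\<close>

definition dual_rep :: "('a \<Rightarrow> 'a \<Rightarrow> 'a) \<Rightarrow> 'a \<Rightarrow> ('a \<Rightarrow> 'k::field) \<Rightarrow> 'a \<Rightarrow> 'k" where
  "dual_rep f x u = (\<lambda>v. - u (f x v))"

definition transpose_map :: "('a \<Rightarrow> 'a) \<Rightarrow> ('a \<Rightarrow> 'k) \<Rightarrow> 'a \<Rightarrow> 'k" where
  "transpose_map f u = u \<circ> f"

definition left_mult :: "('a \<Rightarrow> 'a \<Rightarrow> 'a) \<Rightarrow> 'a \<Rightarrow> 'a \<Rightarrow> 'a" where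
  "left_mult m x y = m x y"

definition right_mult :: "('a \<Rightarrow> 'a \<Rightarrow> 'a) \<Rightarrow> 'a \<Rightarrow> 'a \<Rightarrow> 'a" where
  "right_mult m x y = m y x"

definition semidirect_scale ::
  "('k::field \<Rightarrow> 'a \<Rightarrow> 'a) \<Rightarrow> 'k \<Rightarrow> 'a \<times> ('a \<Rightarrow> 'k) \<Rightarrow> 'a \<times> ('a \<Rightarrow> 'k)" where
  "semidirect_scale scale c = map_prod (scale c) (\<lambda>u v. c * u v)"

definition semidirect_carrier ::
  "('k::field \<Rightarrow> 'a::ab_group_add \<Rightarrow> 'a) \<Rightarrow> ('a \<times> ('a \<Rightarrow> 'k)) set" where
  "semidirect_carrier scale = UNIV \<times> dual_space scale"

definition semidirect_dot ::
  "('a \<Rightarrow> 'a \<Rightarrow> 'a) \<Rightarrow> ('a \<Rightarrow> 'd \<Rightarrow> 'd) \<Rightarrow> 'a \<times> 'd \<Rightarrow> 'a \<times> 'd \<Rightarrow> 'a \<times> 'd::ab_group_add" where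
  "semidirect_dot dot \<mu> = (\<lambda>(x, a) (y, b). (dot x y, \<mu> x b + \<mu> y a))"

definition semidirect_circ ::
  "('a \<Rightarrow> 'a \<Rightarrow> 'a) \<Rightarrow> ('a \<Rightarrow> 'd \<Rightarrow> 'd) \<Rightarrow> ('a \<Rightarrow> 'd \<Rightarrow> 'd) \<Rightarrow>
   'a \<times> 'd \<Rightarrow> 'a \<times> 'd \<Rightarrow> 'a \<times> 'd::ab_group_add" where
  "semidirect_circ circ l r = (\<lambda>(x, a) (y, b). (circ x y, l x b + r y a))"


section \<open>Tensor powers\<close>

text \<open>
  The spaces \<open>V \<otimes> V\<close> and \<open>V \<otimes> V \<otimes> V\<close> are the free vector spaces on pairs and triples of
  elements of \<open>V\<close> modulo the multilinearity relations. Elements are handled through formal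
  representatives, and a formal tensor represents zero iff it lies in the span of the relations.
  The constructions on formal tensors below are (bi)linear extensions of formulas on generators;
  for multilinear operations on \<open>V\<close> they respect the relations, so the resulting predicates depend
  only on the tensor that is represented.
\<close>

definition free_scale :: "'k::field \<Rightarrow> ('b \<Rightarrow>\<^sub>0 'k) \<Rightarrow> ('b \<Rightarrow>\<^sub>0 'k)" where
  "free_scale c u = Poly_Mapping.map ((*) c) u"

definition tensor2 :: "'v \<Rightarrow> 'v \<Rightarrow> ('v \<times> 'v \<Rightarrow>\<^sub>0 'k::field)" where
  "tensor2 x y = Poly_Mapping.single (x, y) 1"

definition tensor3 :: "'v \<Rightarrow> 'v \<Rightarrow> 'v \<Rightarrow> ('v \<times> 'v \<times> 'v \<Rightarrow>\<^sub>0 'k::field)" where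
  "tensor3 x y z = Poly_Mapping.single (x, y, z) 1"

definition linear_relations ::
  "('k::field \<Rightarrow> 'v::ab_group_add \<Rightarrow> 'v) \<Rightarrow> 'v set \<Rightarrow> ('v \<Rightarrow> ('b \<Rightarrow>\<^sub>0 'k)) \<Rightarrow> ('b \<Rightarrow>\<^sub>0 'k) set" where
  "linear_relations scale V t =
     {t (x + y) - t x - t y | x y. x \<in> V \<and> y \<in> V} \<union>
     {t (scale c x) - free_scale c (t x) | c x. x \<in> V}"

definition tensor2_relations ::
  "('k::field \<Rightarrow> 'v::ab_group_add \<Rightarrow> 'v) \<Rightarrow> 'v set \<Rightarrow> ('v \<times> 'v \<Rightarrow>\<^sub>0 'k) set" where
  "tensor2_relations scale V =
     (\<Union>y\<in>V. linear_relations scale V (\<lambda>x. tensor2 x y) \<union>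
             linear_relations scale V (\<lambda>x. tensor2 y x))"

definition tensor3_relations ::
  "('k::field \<Rightarrow> 'v::ab_group_add \<Rightarrow> 'v) \<Rightarrow> 'v set \<Rightarrow> ('v \<times> 'v \<times> 'v \<Rightarrow>\<^sub>0 'k) set" where
  "tensor3_relations scale V =
     (\<Union>y\<in>V. \<Union>z\<in>V. linear_relations scale V (\<lambda>x. tensor3 x y z) \<union>
                    linear_relations scale V (\<lambda>x. tensor3 y x z) \<union>
                    linear_relations scale V (\<lambda>x. tensor3 y z x))"

definition tensor2_zero ::
  "('k::field \<Rightarrow> 'v::ab_group_add \<Rightarrow> 'v) \<Rightarrow> 'v set \<Rightarrow> ('v \<times> 'v \<Rightarrow>\<^sub>0 'k) \<Rightarrow> bool" where
  "tensor2_zero scale V u \<longleftrightarrow> u \<in> module.span free_scale (tensor2_relations scale V)"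

definition tensor3_zero ::
  "('k::field \<Rightarrow> 'v::ab_group_add \<Rightarrow> 'v) \<Rightarrow> 'v set \<Rightarrow> ('v \<times> 'v \<times> 'v \<Rightarrow>\<^sub>0 'k) \<Rightarrow> bool" where
  "tensor3_zero scale V u \<longleftrightarrow> u \<in> module.span free_scale (tensor3_relations scale V)"

definition free_extend ::
  "('b \<Rightarrow> ('c \<Rightarrow>\<^sub>0 'k)) \<Rightarrow> ('b \<Rightarrow>\<^sub>0 'k::field) \<Rightarrow> ('c \<Rightarrow>\<^sub>0 'k)" where
  "free_extend f u = (\<Sum>p\<in>Poly_Mapping.keys u. free_scale (Poly_Mapping.lookup u p) (f p))"

definition flip :: "('v \<times> 'v \<Rightarrow>\<^sub>0 'k::field) \<Rightarrow> ('v \<times> 'v \<Rightarrow>\<^sub>0 'k)" where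
  "flip = free_extend (\<lambda>(x, y). tensor2 y x)"

definition tensor_map ::
  "('v \<Rightarrow> 'v) \<Rightarrow> ('v \<Rightarrow> 'v) \<Rightarrow> ('v \<times> 'v \<Rightarrow>\<^sub>0 'k::field) \<Rightarrow> ('v \<times> 'v \<Rightarrow>\<^sub>0 'k)" where
  "tensor_map f g = free_extend (\<lambda>(x, y). tensor2 (f x) (g y))"


section \<open>The relative PCA Yang-Baxter equation\<close>

definition YBE_A ::
  "('v \<Rightarrow> 'v \<Rightarrow> 'v) \<Rightarrow> ('v \<times> 'v \<Rightarrow>\<^sub>0 'k::field) \<Rightarrow> ('v \<times> 'v \<times> 'v \<Rightarrow>\<^sub>0 'k)" where
  "YBE_A dot r =
     free_extend (\<lambda>(a, b). free_extend (\<lambda>(a', b').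
         tensor3 (dot a a') b b' - tensor3 a (dot a' b) b' + tensor3 a a' (dot b b')) r) r"

definition YBE_T ::
  "('v \<Rightarrow> 'v \<Rightarrow> 'v) \<Rightarrow> ('v::ab_group_add \<times> 'v \<Rightarrow>\<^sub>0 'k::field) \<Rightarrow> ('v \<times> 'v \<times> 'v \<Rightarrow>\<^sub>0 'k)" where
  "YBE_T circ r =
     free_extend (\<lambda>(a, b). free_extend (\<lambda>(a', b').
         tensor3 (circ a a') b b' + tensor3 a (circ b a') b'
         - tensor3 a a' (commutator circ b b')) r) r"

definition antisymmetric_tensor ::
  "('k::field \<Rightarrow> 'v::ab_group_add \<Rightarrow> 'v) \<Rightarrow> 'v set \<Rightarrow> ('v \<times> 'v \<Rightarrow>\<^sub>0 'k) \<Rightarrow> bool" where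
  "antisymmetric_tensor scale V r \<longleftrightarrow> tensor2_zero scale V (flip r - (- r))"

definition RPCA_YBE_solution ::
  "('k::field \<Rightarrow> 'v::ab_group_add \<Rightarrow> 'v) \<Rightarrow> 'v set \<Rightarrow> ('v \<Rightarrow> 'v \<Rightarrow> 'v) \<Rightarrow> ('v \<Rightarrow> 'v \<Rightarrow> 'v) \<Rightarrow>
   ('v \<Rightarrow> 'v) \<Rightarrow> ('v \<Rightarrow> 'v) \<Rightarrow> ('v \<times> 'v \<Rightarrow>\<^sub>0 'k) \<Rightarrow> bool" where
  "RPCA_YBE_solution scale V dot circ P Q r \<longleftrightarrow>
     Poly_Mapping.keys r \<subseteq> V \<times> V \<and>
     tensor3_zero scale V (YBE_A dot r) \<and>
     tensor3_zero scale V (YBE_T circ r) \<and>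
     tensor2_zero scale V (tensor_map Q id r - tensor_map id P r) \<and>
     tensor2_zero scale V (tensor_map P id r - tensor_map id Q r)"

end

theory Submission
  imports Defs
begin

text \<open>
  The space \<open>V = A \<oplus> A\<^sup>*\<close> carries the symmetric nondegenerate form
  \<open>\<langle>x + a, y + b\<rangle> = a(y) + b(x)\<close>, so a tensor over \<open>V\<close> vanishes as soon as all its pairings with
  elements of \<open>V\<close> vanish. Contracting one leg of \<open>r\<close> with \<open>\<phi> = x + a\<close> yields, up to sign,
  \<open>\<rho>(\<phi>) = x - a\<close>. Hence the Yang-Baxter equation paired with \<open>\<phi>, \<psi>, \<chi>\<close> reduces to
  \<open>\<langle>\<phi>, \<rho>\<psi> \<cdot> \<rho>\<chi>\<rangle> + \<langle>\<psi>, \<rho>\<chi> \<cdot> \<rho>\<phi>\<rangle> + \<langle>\<chi>, \<rho>\<phi> \<cdot> \<rho>\<psi>\<rangle> = 0\<close> and its analogue for \<open>\<circ>\<close>, both immediate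
  from the splitting of \<open>\<cdot>\<close> and \<open>\<circ>\<close> into \<open>\<star>\<close>, \<open>\<succ>\<close>, \<open>\<prec>\<close>. Each axiom of a relative PCA algebra on \<open>V\<close>,
  evaluated at \<open>v \<in> A\<close>, splits into one identity in \<open>A\<close> for every functional argument, and each of
  these is an integral linear combination of instances of the pre-PCA axioms and of \<open>Q\<close> applied
  to the Zinbiel identity.
\<close>

section \<open>Detecting zero tensors by functionals\<close>

lemma lookup_free_scale [simp]:
  "Poly_Mapping.lookup (free_scale c u) p = c * Poly_Mapping.lookup u p"
  by (simp add: free_scale_def Poly_Mapping.map.rep_eq when_def)

lemma keys_free_scale: "Poly_Mapping.keys (free_scale c u) \<subseteq> Poly_Mapping.keys u"
  by (auto simp: in_keys_iff)

interpretation free: vector_space "free_scale :: 'k::field \<Rightarrow> ('b \<Rightarrow>\<^sub>0 'k) \<Rightarrow> ('b \<Rightarrow>\<^sub>0 'k)"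
  by unfold_locales (auto intro!: poly_mapping_eqI simp: lookup_add algebra_simps)

text \<open>The scalar-valued counterpart of \<open>free_extend\<close>: the linear functional on
  formal sums with prescribed values on generators. For \<open>F\<close> a product of functionals of
  the legs, it pairs a tensor with a tensor of functionals.\<close>

definition free_eval :: "('b \<Rightarrow> 'k::field) \<Rightarrow> ('b \<Rightarrow>\<^sub>0 'k) \<Rightarrow> 'k" where
  "free_eval F u = (\<Sum>p\<in>Poly_Mapping.keys u. Poly_Mapping.lookup u p * F p)"

text \<open>Coefficients vanish off the keys, so several formal sums can be evaluated over one
  common index set; additivity rests on this, since cancellation may shrink the keys of a
  sum.\<close>

lemma free_eval_superset:
  assumes "finite S" "Poly_Mapping.keys u \<subseteq> S"
  shows "free_eval F u = (\<Sum>p\<in>S. Poly_Mapping.lookup u p * F p)"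
  unfolding free_eval_def using assms
  by (intro sum.mono_neutral_left) (auto simp: in_keys_iff)

lemma free_eval_add: "free_eval F (u + v) = free_eval F u + free_eval F v"
proof -
  let ?S = "Poly_Mapping.keys u \<union> Poly_Mapping.keys v"
  have S: "finite ?S" "Poly_Mapping.keys (u + v) \<subseteq> ?S" by (simp_all add: keys_add)
  show ?thesis
    by (simp add: free_eval_superset[OF S] free_eval_superset[OF S(1), of u]
        free_eval_superset[OF S(1), of v] lookup_add algebra_simps sum.distrib)
qed

lemma free_eval_scale: "free_eval F (free_scale c u) = c * free_eval F u"
  unfolding free_eval_superset[OF finite_keys keys_free_scale]
  by (simp add: free_eval_def sum_distrib_left mult.assoc)

lemma free_eval_zero [simp]: "free_eval F 0 = 0"
  by (simp add: free_eval_def)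

lemma free_eval_diff: "free_eval F (u - v) = free_eval F u - free_eval F v"
  using free_eval_add[of F "u - v" v] by simp

lemma free_eval_sum: "free_eval F (\<Sum>i\<in>I. u i) = (\<Sum>i\<in>I. free_eval F (u i))"
  by (induction I rule: infinite_finite_induct) (simp_all add: free_eval_add)

lemma free_eval_single [simp]: "free_eval F (Poly_Mapping.single p 1) = F p"
  by (simp add: free_eval_def)

text \<open>Moves a functional inside a linear extension; this turns pairings of
  \<open>flip r\<close>, \<open>tensor_map f g r\<close> and the Yang-Baxter expressions into
  evaluations on \<open>r\<close> itself.\<close>

lemma free_eval_free_extend:
  "free_eval F (free_extend g u) = free_eval (\<lambda>p. free_eval F (g p)) u"
  unfolding free_extend_def by (simp add: free_eval_sum free_eval_scale) (simp add: free_eval_def)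

lemma free_eval_cong:
  "(\<And>p. p \<in> Poly_Mapping.keys u \<Longrightarrow> F p = G p) \<Longrightarrow> free_eval F u = free_eval G u"
  by (simp add: free_eval_def)

lemma free_eval_fun_add: "free_eval (\<lambda>p. F p + G p) u = free_eval F u + free_eval G u"
  by (simp add: free_eval_def algebra_simps sum.distrib)

lemma free_eval_fun_diff: "free_eval (\<lambda>p. F p - G p) u = free_eval F u - free_eval G u"
  by (simp add: free_eval_def algebra_simps sum_subtractf)

lemma free_eval_fun_cmult: "free_eval (\<lambda>p. c * F p) u = c * free_eval F u"
  by (simp add: free_eval_def sum_distrib_left algebra_simps)

lemma keys_free_extend:
  "Poly_Mapping.keys (free_extend f u) \<subseteq> (\<Union>p\<in>Poly_Mapping.keys u. Poly_Mapping.keys (f p))"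
  unfolding free_extend_def by (intro order_trans[OF keys_sum] UN_mono order_refl keys_free_scale)

section \<open>Coordinates of formal tensors modulo the multilinearity relations\<close>

lemma free_expansion:
  "u = (\<Sum>p\<in>Poly_Mapping.keys u.
     free_scale (Poly_Mapping.lookup u p) (Poly_Mapping.single p 1))"
proof (rule poly_mapping_eqI)
  fix q
  show "Poly_Mapping.lookup u q = Poly_Mapping.lookup (\<Sum>p\<in>Poly_Mapping.keys u.
      free_scale (Poly_Mapping.lookup u p) (Poly_Mapping.single p 1)) q"
    by (simp add: lookup_sum lookup_single when_def if_distrib sum.delta in_keys_iff cong: if_cong)
qed

text \<open>Modulo \<open>M\<close> each generator \<open>p\<close> is the combination of the
  \<open>s \<alpha>\<close> with coefficients \<open>F \<alpha> p\<close>; summing over the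
  generators of \<open>u\<close> leaves the coefficient \<open>free_eval (F \<alpha>) u\<close> at
  \<open>s \<alpha>\<close>, and these all vanish.\<close>

lemma free_in_subspace_if_eval_zero:
  assumes M: "free.subspace M" and J: "finite J"
    and expand: "\<And>p. p \<in> Poly_Mapping.keys u \<Longrightarrow>
      Poly_Mapping.single p 1 - (\<Sum>\<alpha>\<in>J. free_scale (F \<alpha> p) (s \<alpha>)) \<in> M"
    and zero: "\<And>\<alpha>. \<alpha> \<in> J \<Longrightarrow> free_eval (F \<alpha>) u = 0"
  shows "u \<in> M"
proof -
  let ?c = "Poly_Mapping.lookup u"
  have "(\<Sum>p\<in>Poly_Mapping.keys u. free_scale (?c p) (\<Sum>\<alpha>\<in>J. free_scale (F \<alpha> p) (s \<alpha>)))
      = (\<Sum>p\<in>Poly_Mapping.keys u. \<Sum>\<alpha>\<in>J. free_scale (?c p * F \<alpha> p) (s \<alpha>))"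
    by (simp add: free.scale_sum_right)
  also have "\<dots> = (\<Sum>\<alpha>\<in>J. \<Sum>p\<in>Poly_Mapping.keys u. free_scale (?c p * F \<alpha> p) (s \<alpha>))"
    by (rule sum.swap)
  also have "\<dots> = (\<Sum>\<alpha>\<in>J. free_scale (free_eval (F \<alpha>) u) (s \<alpha>))"
    by (simp add: free_eval_def free.scale_sum_left)
  also have "\<dots> = 0" by (simp add: zero)
  \<comment> \<open>Subtracting a double sum equal to zero writes \<open>u\<close> as a combination
    of the expansion errors, each of which lies in \<open>M\<close>.\<close>
  finally have "u = (\<Sum>p\<in>Poly_Mapping.keys u. free_scale (?c p)
      (Poly_Mapping.single p 1 - (\<Sum>\<alpha>\<in>J. free_scale (F \<alpha> p) (s \<alpha>))))"
    using free_expansion[of u] by (simp add: free.scale_right_diff_distrib sum_subtractf)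
  also have "\<dots> \<in> M"
    by (intro free.subspace_sum[OF M] free.subspace_scale[OF M] expand)
  finally show ?thesis .
qed

text \<open>One summand is peeled off at a time: an additivity relation splits it from the rest, and
  a homogeneity relation extracts its coefficient.\<close>

lemma expand_mod_linear_relations:
  assumes V: "vector_space scale" "module.subspace scale V" and M: "free.subspace M"
    and t: "linear_relations scale V t \<subseteq> M"
    and I: "finite I" "\<And>i. i \<in> I \<Longrightarrow> b i \<in> V"
  shows "t (\<Sum>i\<in>I. scale (c i) (b i)) - (\<Sum>i\<in>I. free_scale (c i) (t (b i))) \<in> M"
  using I
proof (induction I rule: finite_induct)
  interpret vector_space scale by fact
  case empty
  \<comment> \<open>Homogeneity with scalar 0 puts \<open>t 0\<close> into \<open>M\<close>, which
    is what the empty sum asks for.\<close>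
  have "t (scale 0 0) - free_scale 0 (t 0) \<in> M"
    using t subspace_0[OF V(2)] unfolding linear_relations_def by blast
  then show ?case by simp
next
  interpret vector_space scale by fact
  case (insert j I)
  let ?x = "scale (c j) (b j)" and ?y = "\<Sum>i\<in>I. scale (c i) (b i)"
  have y: "?y \<in> V" and x: "?x \<in> V"
    using insert.prems by (auto intro!: subspace_sum[OF V(2)] subspace_scale[OF V(2)])
  have "t (?x + ?y) - t ?x - t ?y \<in> M" and "t ?x - free_scale (c j) (t (b j)) \<in> M"
    using t x y insert.prems unfolding linear_relations_def by blast+
  moreover have "t ?y - (\<Sum>i\<in>I. free_scale (c i) (t (b i))) \<in> M"
    using insert by blast
  ultimately have "t (?x + ?y) - t ?x - t ?y + (t ?x - free_scale (c j) (t (b j)))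
      + (t ?y - (\<Sum>i\<in>I. free_scale (c i) (t (b i)))) \<in> M"
    by (intro free.subspace_add[OF M])
  then show ?case using insert.hyps by (simp add: algebra_simps)
qed

text \<open>A finite spanning family with coordinate functions. The index type is left free so that
  the two halves of a basis of the semi-direct product can be indexed by a disjoint sum.\<close>

locale dual_family = vector_space scale
  for scale :: "'k::field \<Rightarrow> 'v::ab_group_add \<Rightarrow> 'v" +
  fixes V :: "'v set" and I :: "'i set" and b :: "'i \<Rightarrow> 'v" and f :: "'i \<Rightarrow> 'v \<Rightarrow> 'k"
  assumes subspace: "subspace V" and finite: "finite I" and mem: "i \<in> I \<Longrightarrow> b i \<in> V"
    and expansion: "x \<in> V \<Longrightarrow> x = (\<Sum>i\<in>I. scale (f i x) (b i))"
begin

lemma span_eq: "span (b ` I) = V"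
proof
  show "span (b ` I) \<subseteq> V" using mem by (intro span_minimal subspace) auto
  show "V \<subseteq> span (b ` I)"
  proof
    fix x assume "x \<in> V"
    then have "x = (\<Sum>i\<in>I. scale (f i x) (b i))" by (rule expansion)
    also have "\<dots> \<in> span (b ` I)" by (intro span_sum span_scale span_base) auto
    finally show "x \<in> span (b ` I)" .
  qed
qed

lemma expand_tensor:
  assumes "free.subspace M" "linear_relations scale V t \<subseteq> M" "x \<in> V"
  shows "t x - (\<Sum>i\<in>I. free_scale (f i x) (t (b i))) \<in> M"
proof -
  have "t (\<Sum>i\<in>I. scale (f i x) (b i)) - (\<Sum>i\<in>I. free_scale (f i x) (t (b i))) \<in> M"
    by (rule expand_mod_linear_relations[OF vector_space_axioms subspace assms(1,2) finite mem])
  then show ?thesis by (simp flip: expansion[OF assms(3)])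
qed

text \<open>Expanding the first leg and then the second reduces a generator, modulo relations, to
  the tensors of the \<open>b i\<close>; the evaluations assumed to vanish are the resulting
  coefficients of \<open>u\<close>.\<close>

lemma tensor2_zeroI:
  assumes keys: "Poly_Mapping.keys u \<subseteq> V \<times> V"
    and zero: "\<And>i j. i \<in> I \<Longrightarrow> j \<in> I \<Longrightarrow> free_eval (\<lambda>(x, y). f i x * f j y) u = 0"
  shows "tensor2_zero scale V u"
  unfolding tensor2_zero_def
proof (rule free_in_subspace_if_eval_zero)
  let ?M = "free.span (tensor2_relations scale V)"
  let ?t = "tensor2 :: _ \<Rightarrow> _ \<Rightarrow> _ \<Rightarrow>\<^sub>0 'k"
  show M: "free.subspace ?M" by simp
  show "finite (I \<times> I)" using finite by simp
  show "free_eval ((\<lambda>(i, j) (x, y). f i x * f j y) \<alpha>) u = 0" if "\<alpha> \<in> I \<times> I" for \<alpha>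
    using that zero by auto
  fix p assume "p \<in> Poly_Mapping.keys u"
  then obtain x y where p: "p = (x, y)" "x \<in> V" "y \<in> V" using keys by auto
  have rel: "linear_relations scale V (\<lambda>x. ?t x z) \<subseteq> ?M"
    "linear_relations scale V (\<lambda>x. ?t z x) \<subseteq> ?M" if "z \<in> V" for z
    using that free.span_superset[of "tensor2_relations scale V"]
    unfolding tensor2_relations_def by blast+
  have "?t x y - (\<Sum>i\<in>I. free_scale (f i x) (?t (b i) y)) \<in> ?M"
    using expand_tensor[OF M rel(1)] p by blast
  moreover have "(\<Sum>i\<in>I. free_scale (f i x)
      (?t (b i) y - (\<Sum>j\<in>I. free_scale (f j y) (?t (b i) (b j))))) \<in> ?M"
    using expand_tensor[OF M rel(2)] p mem
    by (intro free.subspace_sum[OF M] free.subspace_scale[OF M]) blast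
  \<comment> \<open>The half-expanded terms, with first leg \<open>b i\<close> and second leg
    \<open>y\<close>, cancel between the two errors.\<close>
  ultimately have "?t x y - (\<Sum>i\<in>I. free_scale (f i x) (?t (b i) y)) + (\<Sum>i\<in>I. free_scale (f i x)
      (?t (b i) y - (\<Sum>j\<in>I. free_scale (f j y) (?t (b i) (b j))))) \<in> ?M"
    by (rule free.subspace_add[OF M])
  also have "?t x y - (\<Sum>i\<in>I. free_scale (f i x) (?t (b i) y)) + (\<Sum>i\<in>I. free_scale (f i x)
      (?t (b i) y - (\<Sum>j\<in>I. free_scale (f j y) (?t (b i) (b j)))))
    = ?t x y - (\<Sum>i\<in>I. \<Sum>j\<in>I. free_scale (f i x * f j y) (?t (b i) (b j)))"
    by (simp add: free.scale_right_diff_distrib sum_subtractf free.scale_sum_right)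
  finally show "Poly_Mapping.single p 1 - (\<Sum>\<alpha>\<in>I \<times> I.
      free_scale ((\<lambda>(i, j) (x, y). f i x * f j y) \<alpha> p) ((\<lambda>(i, j). ?t (b i) (b j)) \<alpha>)) \<in> ?M"
    by (simp add: p tensor2_def sum.cartesian_product case_prod_unfold)
qed

text \<open>The same successive expansion as for two legs, with a third one nested inside.\<close>

lemma tensor3_zeroI:
  assumes keys: "Poly_Mapping.keys u \<subseteq> V \<times> V \<times> V"
    and zero: "\<And>i j k. i \<in> I \<Longrightarrow> j \<in> I \<Longrightarrow> k \<in> I \<Longrightarrow>
      free_eval (\<lambda>(x, y, z). f i x * f j y * f k z) u = 0"
  shows "tensor3_zero scale V u"
  unfolding tensor3_zero_def
proof (rule free_in_subspace_if_eval_zero)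
  let ?M = "free.span (tensor3_relations scale V)"
  let ?t = "tensor3 :: _ \<Rightarrow> _ \<Rightarrow> _ \<Rightarrow> _ \<Rightarrow>\<^sub>0 'k"
  show M: "free.subspace ?M" by simp
  show "finite (I \<times> I \<times> I)" using finite by simp
  show "free_eval ((\<lambda>(i, j, k) (x, y, z). f i x * f j y * f k z) \<alpha>) u = 0"
    if "\<alpha> \<in> I \<times> I \<times> I" for \<alpha>
    using that zero by auto
  fix p assume "p \<in> Poly_Mapping.keys u"
  then obtain x y z where p: "p = (x, y, z)" "x \<in> V" "y \<in> V" "z \<in> V" using keys by auto
  have rel: "linear_relations scale V (\<lambda>x. ?t x y z) \<subseteq> ?M"
    "linear_relations scale V (\<lambda>x. ?t y x z) \<subseteq> ?M"
    "linear_relations scale V (\<lambda>x. ?t y z x) \<subseteq> ?M" if "y \<in> V" "z \<in> V" for y z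
    using that free.span_superset[of "tensor3_relations scale V"]
    unfolding tensor3_relations_def by blast+
  have "?t x y z - (\<Sum>i\<in>I. free_scale (f i x) (?t (b i) y z)) \<in> ?M"
    using expand_tensor[OF M rel(1)] p by blast
  moreover have "(\<Sum>i\<in>I. free_scale (f i x)
      (?t (b i) y z - (\<Sum>j\<in>I. free_scale (f j y) (?t (b i) (b j) z)))) \<in> ?M"
    using expand_tensor[OF M rel(2)] p mem
    by (intro free.subspace_sum[OF M] free.subspace_scale[OF M]) blast
  moreover have "(\<Sum>i\<in>I. free_scale (f i x) (\<Sum>j\<in>I. free_scale (f j y)
      (?t (b i) (b j) z - (\<Sum>k\<in>I. free_scale (f k z) (?t (b i) (b j) (b k)))))) \<in> ?M"
    using expand_tensor[OF M rel(3)] p mem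
    by (intro free.subspace_sum[OF M] free.subspace_scale[OF M]) blast
  ultimately have "?t x y z - (\<Sum>i\<in>I. free_scale (f i x) (?t (b i) y z)) + (\<Sum>i\<in>I. free_scale (f i x)
      (?t (b i) y z - (\<Sum>j\<in>I. free_scale (f j y) (?t (b i) (b j) z)))) +
      (\<Sum>i\<in>I. free_scale (f i x) (\<Sum>j\<in>I. free_scale (f j y)
      (?t (b i) (b j) z - (\<Sum>k\<in>I. free_scale (f k z) (?t (b i) (b j) (b k)))))) \<in> ?M"
    by (intro free.subspace_add[OF M])
  also have "?t x y z - (\<Sum>i\<in>I. free_scale (f i x) (?t (b i) y z)) + (\<Sum>i\<in>I. free_scale (f i x)
      (?t (b i) y z - (\<Sum>j\<in>I. free_scale (f j y) (?t (b i) (b j) z)))) +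
      (\<Sum>i\<in>I. free_scale (f i x) (\<Sum>j\<in>I. free_scale (f j y)
      (?t (b i) (b j) z - (\<Sum>k\<in>I. free_scale (f k z) (?t (b i) (b j) (b k))))))
    = ?t x y z - (\<Sum>i\<in>I. \<Sum>j\<in>I. \<Sum>k\<in>I. free_scale (f i x * f j y * f k z) (?t (b i) (b j) (b k)))"
    by (simp add: free.scale_right_diff_distrib sum_subtractf free.scale_sum_right mult.assoc)
  finally show "Poly_Mapping.single p 1 - (\<Sum>\<alpha>\<in>I \<times> I \<times> I.
      free_scale ((\<lambda>(i, j, k) (x, y, z). f i x * f j y * f k z) \<alpha> p)
        ((\<lambda>(i, j, k). ?t (b i) (b j) (b k)) \<alpha>)) \<in> ?M"
    by (simp add: p tensor3_def sum.cartesian_product case_prod_unfold)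
qed

end

section \<open>The semi-direct product\<close>

context vector_space
begin

lemma dual_space_iff:
  "u \<in> dual_space scale \<longleftrightarrow>
     (\<forall>x y. u (x + y) = u x + u y) \<and> (\<forall>c x. u (scale c x) = c * u x)"
proof -
  have "vector_space ((*) :: 'a \<Rightarrow> 'a \<Rightarrow> 'a)" by unfold_locales (simp_all add: algebra_simps)
  then show ?thesis
    by (simp add: dual_space_def Vector_Spaces.linear_iff vector_space_axioms)
qed

lemma dual_space_simps:
  assumes "u \<in> dual_space scale"
  shows "u (x + y) = u x + u y" "u (scale c x) = c * u x" "u 0 = 0" "u (- x) = - u x"
    "u (x - y) = u x - u y"
proof -
  show add: "u (x + y) = u x + u y" and scale: "u (scale c x) = c * u x" for x y c
    using assms by (auto simp: dual_space_iff)
  show zero: "u 0 = 0" using scale[of 0 0] by simp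
  show minus: "u (- x) = - u x" for x using add[of x "- x"] zero by (simp add: eq_neg_iff_add_eq_0 add.commute)
  show "u (x - y) = u x - u y" using add[of x "- y"] minus by simp
qed

lemma dual_space_sum:
  "u \<in> dual_space scale \<Longrightarrow> u (\<Sum>i\<in>I. x i) = (\<Sum>i\<in>I. u (x i))"
  by (induction I rule: infinite_finite_induct) (simp_all add: dual_space_simps)

lemma vector_space_semidirect_scale: "vector_space (semidirect_scale scale)"
  by unfold_locales
    (auto simp: semidirect_scale_def prod_eq_iff fun_eq_iff algebra_simps
      scale_right_distrib scale_left_distrib)

lemma subspace_semidirect_carrier:
  "module.subspace (semidirect_scale scale) (semidirect_carrier scale)"
proof -
  interpret S: vector_space "semidirect_scale scale" by (rule vector_space_semidirect_scale)
  show ?thesis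
    unfolding S.subspace_def
    by (auto simp: semidirect_scale_def semidirect_carrier_def dual_space_iff algebra_simps
        zero_prod_def)
qed

end

section \<open>Linearity rules and equational certificates\<close>

lemma linear_simps:
  assumes "Vector_Spaces.linear scale scale f"
  shows "f (x + y) = f x + f y" "f (scale c x) = scale c (f x)" "f 0 = 0" "f (- x) = - f x"
    "f (x - y) = f x - f y"
proof -
  interpret Vector_Spaces.linear scale scale f by fact
  show "f (x + y) = f x + f y" "f (scale c x) = scale c (f x)" "f 0 = 0" "f (- x) = - f x"
    "f (x - y) = f x - f y"
    by (simp_all add: add scale zero neg diff)
qed

lemma bilinear_op_simps:
  assumes "bilinear_op scale m"
  shows "m (x + x') y = m x y + m x' y" "m (scale c x) y = scale c (m x y)" "m 0 y = 0"
    "m (- x) y = - m x y" "m (x - x') y = m x y - m x' y"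
    "m x (y + y') = m x y + m x y'" "m x (scale c y) = scale c (m x y)" "m x 0 = 0"
    "m x (- y) = - m x y" "m x (y - y') = m x y - m x y'"
  using assms linear_simps[of scale "m x"] linear_simps[of scale "\<lambda>x. m x y"]
  by (auto simp: bilinear_op_def)

text \<open>The certificate principle behind the axiom checks: \<open>p = q\<close> is a sum of
  axiom instances assembled with \<open>add_eqs\<close>, and \<open>l - r = p - q\<close> is then a
  formal identity, settled by multilinear expansion.\<close>

lemma eq_if_diff_eq:
  fixes l r :: "'a::ab_group_add"
  shows "p = q \<Longrightarrow> l - r = p - q \<Longrightarrow> l = r"
  by simp

lemma pair_fun_eqI: "fst X = fst Y \<Longrightarrow> (\<And>v. snd X v = snd Y v) \<Longrightarrow> X = Y"
  by (simp add: prod_eq_iff fun_eq_iff)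

lemmas add_eqs = arg_cong2[where f="(+)"]

section \<open>The operations of the semi-direct product on pairs\<close>

context relative_pre_PCA_algebra
begin

abbreviation scaleV where "scaleV \<equiv> semidirect_scale scale"
abbreviation V where "V \<equiv> semidirect_carrier scale"
abbreviation dotV where
  "dotV \<equiv> semidirect_dot (sub_dot (\<star>)) (- dual_rep (left_mult (\<star>)))"
abbreviation circV where
  "circV \<equiv> semidirect_circ (sub_circ (\<succ>) (\<prec>))
     (dual_rep (right_mult (\<prec>)) - dual_rep (left_mult (\<succ>))) (dual_rep (right_mult (\<prec>)))"
abbreviation PV where "PV \<equiv> map_prod P (transpose_map Q)"
abbreviation QV where "QV \<equiv> map_prod Q (transpose_map P)"

text \<open>The sign in front of \<open>dual_rep\<close> undoes the one built into it, so
  functionals are acted on by plain transposes of left Zinbiel multiplications.\<close>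

lemma dotV_pair: "dotV (x, a) (y, b) = (x \<cdot> y, \<lambda>v. b (x \<star> v) + a (y \<star> v))"
  by (simp add: semidirect_dot_def dual_rep_def left_mult_def fun_eq_iff)

text \<open>For linear \<open>b\<close> the terms in \<open>b\<close> amount to
  \<open>b (x \<diamondop> v)\<close>, which is how the pre-Lie product enters the axioms.\<close>

lemma circV_pair:
  "circV (x, a) (y, b) = (x \<odot> y, \<lambda>v. b (x \<succ> v) - b (v \<prec> x) - a (v \<prec> y))"
  by (simp add: semidirect_circ_def dual_rep_def left_mult_def right_mult_def fun_eq_iff)

text \<open>The \<open>\<prec>\<close> terms of \<open>circV\<close> are symmetric in the two
  factors and cancel; only actions through \<open>\<succ>\<close> survive.\<close>

lemma bracketV_pair:
  "commutator circV (x, a) (y, b) = (bracket x y, \<lambda>v. b (x \<succ> v) - a (y \<succ> v))"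
  by (simp add: commutator_def circV_pair fun_eq_iff algebra_simps)

lemma PV_pair: "PV (x, a) = (P x, \<lambda>v. a (Q v))"
  and QV_pair: "QV (x, a) = (Q x, \<lambda>v. a (P v))"
  by (simp_all add: transpose_map_def o_def)

lemma scaleV_pair: "scaleV c (x, a) = (scale c x, \<lambda>v. c * a v)"
  by (simp add: semidirect_scale_def)

lemma V_pair: "(x, a) \<in> V \<longleftrightarrow> a \<in> dual_space scale"
  by (simp add: semidirect_carrier_def)

lemmas operation_pairs = dotV_pair circV_pair bracketV_pair PV_pair QV_pair scaleV_pair V_pair

lemmas operation_simps =
  bilinear_op_simps[OF star_bilinear] bilinear_op_simps[OF succ_bilinear]
  bilinear_op_simps[OF prec_bilinear] linear_simps[OF P_linear] linear_simps[OF Q_linear]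

lemmas expand = operation_simps sub_dot_def sub_circ_def sub_diamond_def commutator_def

lemma PV_linear: "linear_on scaleV V PV" and QV_linear: "linear_on scaleV V QV"
  by (auto simp: linear_on_def operation_pairs dual_space_iff operation_simps fun_eq_iff
      simp del: map_prod_simp)

lemma dotV_bilinear: "bilinear_on scaleV V dotV"
  by (auto simp: bilinear_on_def linear_on_def operation_pairs dual_space_iff expand fun_eq_iff
      scale_right_distrib algebra_simps)

lemma circV_bilinear: "bilinear_on scaleV V circV"
  by (auto simp: bilinear_on_def linear_on_def operation_pairs dual_space_iff expand fun_eq_iff
      scale_right_distrib algebra_simps)

section \<open>The axioms of a relative PCA algebra, checked in both components\<close>

context
  fixes a b c :: "'a \<Rightarrow> 'k"
  assumes a: "a \<in> dual_space scale" and b: "b \<in> dual_space scale" and c: "c \<in> dual_space scale"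
begin

private lemmas functional_expand =
  expand dual_space_simps[OF a] dual_space_simps[OF b] dual_space_simps[OF c] algebra_simps
private lemmas a_eq = arg_cong[where f=a]
private lemmas b_eq = arg_cong[where f=b]
private lemmas c_eq = arg_cong[where f=c]
private lemmas Q_eq = arg_cong[where f=Q]

text \<open>All coefficients come from the Zinbiel identity, read as
  \<open>y \<star> (z \<star> v) = (y \<cdot> z) \<star> v\<close>: left multiplication represents
  the commutative algebra.\<close>

lemma dotV_assoc:
  "dotV (dotV (x, a) (y, b)) (z, c) = dotV (x, a) (dotV (y, b) (z, c))"
  unfolding operation_pairs
  apply (rule pair_fun_eqI)
  subgoal
    by (rule eq_if_diff_eq[OF add_eqs[OF add_eqs[OF zinbiel[of z x y] zinbiel[of z y x]]
        add_eqs[OF zinbiel[of x y z, symmetric] zinbiel[of x z y, symmetric]]]])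
      (simp add: functional_expand)
  subgoal for v
    by (rule eq_if_diff_eq[OF add_eqs[OF add_eqs[OF a_eq[OF zinbiel[of y z v]] b_eq[OF
        zinbiel[of x z v]]] add_eqs[OF b_eq[OF zinbiel[of z x v, symmetric]] c_eq[OF zinbiel[of y x
        v, symmetric]]]]])
      (simp add: functional_expand)
  done

text \<open>The coefficients of \<open>a\<close> and \<open>b\<close> are instances of
  \<open>pre_APL_2\<close>. That of \<open>c\<close> is the pre-Lie identity, since
  \<open>\<diamondop>\<close> and \<open>\<odot>\<close> have the same commutator.\<close>

lemma circV_anti_pre_lie_1:
  "circV (x, a) (circV (y, b) (z, c)) - circV (y, b) (circV (x, a) (z, c)) = circV (commutator
   circV (y, b) (x, a)) (z, c)"
  unfolding operation_pairs
  apply (rule pair_fun_eqI)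
  subgoal
    by (rule eq_if_diff_eq[OF add_eqs[OF pre_APL_2[of x y z] add_eqs[OF pre_APL_2[of y x z,
        symmetric] pre_APL_1[of x y z]]]])
      (simp add: functional_expand)
  subgoal for v
    by (rule eq_if_diff_eq[OF add_eqs[OF a_eq[OF pre_APL_2[of v y z, symmetric]] add_eqs[OF
        b_eq[OF pre_APL_2[of v x z]] c_eq[OF pre_lie[of x y v]]]]])
      (simp add: functional_expand)
  done

text \<open>Since \<open>pre_APL_1\<close> and \<open>pre_APL_3\<close> share their left side, their
  difference trades brackets acting through \<open>\<succ>\<close> for terms in
  \<open>\<prec>\<close>. In A this is summed cyclically; each functional coefficient also takes two
  instances of \<open>pre_APL_2\<close>, antisymmetrized.\<close>

lemma circV_anti_pre_lie_2:
  "circV (commutator circV (x, a) (y, b)) (z, c) + circV (commutator circV (y, b) (z, c)) (x, a) +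
   circV (commutator circV (z, c) (x, a)) (y, b) = 0"
  unfolding operation_pairs
  apply (rule pair_fun_eqI)
  subgoal
    by (rule eq_if_diff_eq[OF add_eqs[OF add_eqs[OF pre_APL_1[of x y z] add_eqs[OF pre_APL_3[of
        x y z, symmetric] pre_APL_1[of y z x]]] add_eqs[OF pre_APL_3[of y z x, symmetric] add_eqs[OF
        pre_APL_1[of x z y, symmetric] pre_APL_3[of x z y]]]]])
      (simp add: functional_expand)
  subgoal for v
    by (rule eq_if_diff_eq[OF add_eqs[OF add_eqs[OF add_eqs[OF a_eq[OF pre_APL_1[of y z v]]
        add_eqs[OF a_eq[OF pre_APL_3[of y z v, symmetric]] a_eq[OF pre_APL_2[of v y z, symmetric]]]]
        add_eqs[OF a_eq[OF pre_APL_2[of v z y]] add_eqs[OF b_eq[OF pre_APL_1[of x z v, symmetric]]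
        b_eq[OF pre_APL_3[of x z v]]]]] add_eqs[OF add_eqs[OF b_eq[OF pre_APL_2[of v z x,
        symmetric]] add_eqs[OF b_eq[OF pre_APL_2[of v x z]] c_eq[OF pre_APL_1[of x y v]]]]
        add_eqs[OF c_eq[OF pre_APL_3[of x y v, symmetric]] add_eqs[OF c_eq[OF pre_APL_2[of v x y,
        symmetric]] c_eq[OF pre_APL_2[of v y x]]]]]]])
      (simp add: functional_expand)
  done

text \<open>In A this is \<open>P_star\<close> twice. As \<open>PV\<close> transposes
  \<open>Q\<close> on functionals, the derivation rule there becomes
  \<open>Q_star_right\<close>.\<close>

lemma PV_dotV:
  "PV (dotV (x, a) (y, b)) = dotV (PV (x, a)) (y, b) + dotV (x, a) (PV (y, b))"
  unfolding operation_pairs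
  apply (rule pair_fun_eqI)
  subgoal
    by (rule eq_if_diff_eq[OF add_eqs[OF P_star[of x y] P_star[of y x]]])
      (simp add: functional_expand)
  subgoal for v
    by (rule eq_if_diff_eq[OF add_eqs[OF a_eq[OF Q_star_right[of y v]] b_eq[OF Q_star_right[of x
        v]]]])
      (simp add: functional_expand)
  done

text \<open>The bracket is also the commutator of \<open>\<diamondop>\<close>, so
  \<open>P_diamond\<close> serves in A; on functionals the rule becomes
  \<open>Q_succ\<close>.\<close>

lemma PV_bracketV:
  "PV (commutator circV (x, a) (y, b)) = commutator circV (PV (x, a)) (y, b) + commutator circV (x,
   a) (PV (y, b))"
  unfolding operation_pairs
  apply (rule pair_fun_eqI)
  subgoal
    by (rule eq_if_diff_eq[OF add_eqs[OF P_diamond[of x y] P_diamond[of y x, symmetric]]])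
      (simp add: functional_expand)
  subgoal for v
    by (rule eq_if_diff_eq[OF add_eqs[OF a_eq[OF Q_succ[of y v, symmetric]] b_eq[OF Q_succ[of x
        v]]]])
      (simp add: functional_expand)
  done

text \<open>The Zinbiel identity rewrites the products with \<open>P z\<close>; the rest is
  \<open>pre_poisson_1\<close> and \<open>pre_poisson_2\<close> in A, \<open>pre_PCA_3\<close> at
  \<open>a\<close> and \<open>b\<close>, and \<open>pre_PCA_5\<close> at \<open>c\<close>.\<close>

lemma bracketV_dotV:
  "commutator circV (z, c) (dotV (x, a) (y, b)) = dotV (commutator circV (z, c) (x, a)) (y, b) +
   dotV (x, a) (commutator circV (z, c) (y, b)) + dotV (dotV (x, a) (y, b)) (PV (z, c))"
  unfolding operation_pairs
  apply (rule pair_fun_eqI)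
  subgoal
    by (rule eq_if_diff_eq[OF add_eqs[OF add_eqs[OF pre_poisson_1[of z y x] pre_poisson_2[of x y
        z, symmetric]] add_eqs[OF pre_poisson_1[of z x y] add_eqs[OF zinbiel[of "P z" x y,
        symmetric] zinbiel[of "P z" y x, symmetric]]]]])
      (simp add: functional_expand)
  subgoal for v
    by (rule eq_if_diff_eq[OF add_eqs[OF add_eqs[OF a_eq[OF pre_PCA_3[of y z v]] a_eq[OF
        zinbiel[of y "P z" v, symmetric]]] add_eqs[OF b_eq[OF pre_PCA_3[of x z v]] add_eqs[OF
        b_eq[OF zinbiel[of x "P z" v, symmetric]] c_eq[OF pre_PCA_5[of x y v, symmetric]]]]]])
      (simp add: functional_expand)
  done

text \<open>\<open>QV\<close> transposes \<open>P\<close> on functionals, so the coefficient of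
  \<open>b\<close> is the derivation rule for \<open>P\<close>, while that of \<open>a\<close> is
  \<open>Q_star_left\<close>.\<close>

lemma QV_dotV:
  "dotV (x, a) (QV (y, b)) - dotV (PV (x, a)) (y, b) - QV (dotV (x, a) (y, b)) = 0"
  unfolding operation_pairs
  apply (rule pair_fun_eqI)
  subgoal
    by (rule eq_if_diff_eq[OF add_eqs[OF Q_star_right[of x y] Q_star_left[of y x]]])
      (simp add: functional_expand)
  subgoal for v
    by (rule eq_if_diff_eq[OF add_eqs[OF a_eq[OF Q_star_left[of y v]] b_eq[OF P_star[of x v]]]])
      (simp add: functional_expand)
  done

lemma QV_circV:
  "circV (x, a) (QV (y, b)) - circV (PV (x, a)) (y, b) - QV (circV (x, a) (y, b)) = 0"
  unfolding operation_pairs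
  apply (rule pair_fun_eqI)
  subgoal
    by (rule eq_if_diff_eq[OF add_eqs[OF Q_succ[of x y] Q_prec[of x y]]])
      (simp add: functional_expand)
  subgoal for v
    by (rule eq_if_diff_eq[OF add_eqs[OF a_eq[OF Q_prec[of v y, symmetric]] b_eq[OF P_diamond[of
        x v]]]])
      (simp add: functional_expand)
  done

text \<open>At \<open>b\<close> the axiom \<open>pre_PCA_4\<close> contains
  \<open>Q ((x \<cdot> z) \<star> v)\<close> where the goal has
  \<open>Q (x \<star> (z \<star> v))\<close>; \<open>Q\<close> applied to the Zinbiel identity
  reconciles them.\<close>

lemma circV_dotV:
  "dotV (x, a) (circV (y, b) (z, c)) - circV (y, b) (dotV (x, a) (z, c)) + dotV (commutator circV
   (x, a) (y, b)) (z, c) - dotV (dotV (x, a) (PV (y, b))) (z, c) = 0"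
  unfolding operation_pairs
  apply (rule pair_fun_eqI)
  subgoal
    by (rule eq_if_diff_eq[OF add_eqs[OF add_eqs[OF pre_PCA_2[of x y z] pre_PCA_1[of y z x]]
        add_eqs[OF pre_PCA_3[of x y z] add_eqs[OF zinbiel[of z x "P y", symmetric] zinbiel[of z "P
        y" x, symmetric]]]]])
      (simp add: functional_expand)
  subgoal for v
    by (rule eq_if_diff_eq[OF add_eqs[OF add_eqs[OF a_eq[OF pre_PCA_1[of y z v]] a_eq[OF
        zinbiel[of "P y" z v, symmetric]]] add_eqs[OF b_eq[OF pre_PCA_4[of x v z, symmetric]]
        add_eqs[OF b_eq[OF Q_eq[OF zinbiel[of x z v, symmetric]]] c_eq[OF pre_poisson_1[of y x
        v]]]]]])
      (simp add: functional_expand)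
  done

text \<open>On functionals the final \<open>QV\<close> term evaluates at \<open>P v\<close>, which
  matches the \<open>P\<close> terms of \<open>pre_PCA_2\<close> and \<open>pre_poisson_2\<close>
  after the Zinbiel identity at \<open>P v\<close>.\<close>

lemma dotV_circV:
  "circV (dotV (x, a) (y, b)) (z, c) - circV (y, b) (dotV (x, a) (z, c)) - circV (x, a) (dotV (y,
   b) (z, c)) + QV (dotV (dotV (x, a) (y, b)) (z, c)) = 0"
  unfolding operation_pairs
  apply (rule pair_fun_eqI)
  subgoal
    by (rule eq_if_diff_eq[OF add_eqs[OF add_eqs[OF pre_PCA_5[of x y z] pre_PCA_4[of x y z]]
        add_eqs[OF pre_PCA_4[of y x z] add_eqs[OF Q_eq[OF zinbiel[of z x y]] Q_eq[OF zinbiel[of z y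
        x]]]]]])
      (simp add: functional_expand)
  subgoal for v
    by (rule eq_if_diff_eq[OF add_eqs[OF add_eqs[OF a_eq[OF pre_PCA_2[of y v z, symmetric]]
        a_eq[OF zinbiel[of y z "P v"]]] add_eqs[OF b_eq[OF pre_PCA_2[of x v z, symmetric]]
        add_eqs[OF b_eq[OF zinbiel[of x z "P v"]] c_eq[OF pre_poisson_2[of x y v]]]]]])
      (simp add: functional_expand)
  done

end

end

section \<open>Contractions of the canonical tensor\<close>

lemma sum_apply: "(\<Sum>i\<in>I. f i) x = (\<Sum>i\<in>I. f i x)"
  by (induction I rule: infinite_finite_induct) simp_all

text \<open>Linearity is asked on \<open>V\<close> alone, because functionals composed with the
  operations are known to be linear only there.\<close>

definition functional_on ::
  "('k::field \<Rightarrow> 'v::ab_group_add \<Rightarrow> 'v) \<Rightarrow> 'v set \<Rightarrow> ('v \<Rightarrow> 'k) \<Rightarrow> bool" where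
  "functional_on scale V L \<longleftrightarrow>
     (\<forall>x\<in>V. \<forall>y\<in>V. L (x + y) = L x + L y) \<and> (\<forall>c. \<forall>x\<in>V. L (scale c x) = c * L x)"

lemma functional_on_linear:
  "functional_on scale V L \<Longrightarrow> linear_on scale V f \<Longrightarrow> functional_on scale V (\<lambda>x. L (f x))"
  by (simp add: functional_on_def linear_on_def)

lemma (in dual_family) functional_expansion:
  assumes L: "functional_on scale V L" and x: "x \<in> V"
  shows "L x = (\<Sum>i\<in>I. f i x * L (b i))"
proof -
  have "L (\<Sum>i\<in>J. scale (f i x) (b i)) = (\<Sum>i\<in>J. f i x * L (b i))" if "finite J" "J \<subseteq> I" for J
    using that
  proof (induction J rule: finite_induct)
    case empty
    have "L (scale 0 0) = 0 * L 0"
      using L subspace_0[OF subspace] unfolding functional_on_def by blast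
    then show ?case by simp
  next
    case (insert j J)
    have "scale (f j x) (b j) \<in> V" "(\<Sum>i\<in>J. scale (f i x) (b i)) \<in> V"
      using insert.prems mem by (auto intro!: subspace_sum[OF subspace] subspace_scale[OF subspace])
    with insert L mem show ?case by (simp add: functional_on_def)
  qed
  from this[OF finite order_refl] show ?thesis by (simp flip: expansion[OF x])
qed

section \<open>The symmetric form and the canonical tensor\<close>

definition pairing ::
  "'a::ab_group_add \<times> ('a \<Rightarrow> 'k) \<Rightarrow> 'a \<times> ('a \<Rightarrow> 'k) \<Rightarrow> 'k::field" where
  "pairing \<phi> X = snd \<phi> (fst X) + snd X (fst \<phi>)"

definition reflect :: "'a \<times> ('a \<Rightarrow> 'k::field) \<Rightarrow> 'a \<times> ('a \<Rightarrow> 'k)" where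
  "reflect \<phi> = (fst \<phi>, - snd \<phi>)"

text \<open>Duality of the two families is recorded as the expansion of vectors, the form in which
  the contractions use it; the main theorem derives it from the Kronecker relations.\<close>

locale dual_basis = vector_space scale
  for scale :: "'k::field \<Rightarrow> 'a::ab_group_add \<Rightarrow> 'a" +
  fixes n :: nat and e :: "nat \<Rightarrow> 'a" and e' :: "nat \<Rightarrow> 'a \<Rightarrow> 'k"
  assumes dual: "i \<in> {1..n} \<Longrightarrow> e' i \<in> dual_space scale"
    and basis_expansion: "x = (\<Sum>i=1..n. scale (e' i x) (e i))"
begin

abbreviation scaleV where "scaleV \<equiv> semidirect_scale scale"
abbreviation V where "V \<equiv> semidirect_carrier scale"

definition r :: "('a \<times> ('a \<Rightarrow> 'k)) \<times> ('a \<times> ('a \<Rightarrow> 'k)) \<Rightarrow>\<^sub>0 'k" where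
  "r = (\<Sum>i=1..n. tensor2 (0, e' i) (e i, 0) - tensor2 (e i, 0) (0, e' i))"

lemma zero_in_dual_space: "0 \<in> dual_space scale"
  by (simp add: dual_space_iff)

lemma basis_mem: "(x, 0) \<in> V" "i \<in> {1..n} \<Longrightarrow> (0, e' i) \<in> V"
  by (simp_all add: semidirect_carrier_def dual zero_in_dual_space)

lemma dual_expansion:
  assumes "a \<in> dual_space scale"
  shows "a v = (\<Sum>i=1..n. a (e i) * e' i v)"
proof -
  have "a v = a (\<Sum>i=1..n. scale (e' i v) (e i))" by (rule arg_cong[OF basis_expansion])
  also have "\<dots> = (\<Sum>i=1..n. a (e i) * e' i v)"
    by (simp add: dual_space_sum[OF assms] dual_space_simps[OF assms] mult.commute)
  finally show ?thesis .
qed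

lemma functional_on_pairing:
  "\<phi> \<in> V \<Longrightarrow> functional_on scaleV V (pairing \<phi>)"
  by (auto simp: functional_on_def pairing_def semidirect_carrier_def semidirect_scale_def
      dual_space_simps algebra_simps)

text \<open>The form pairs the two halves with each other, so the coordinate at \<open>e i\<close>
  is the pairing with \<open>e' i\<close> and vice versa.\<close>

sublocale S: dual_family scaleV V "{1..n} <+> {1..n}"
  "case_sum (\<lambda>i. (e i, 0)) (\<lambda>i. (0, e' i))"
  "case_sum (\<lambda>i. pairing (0, e' i)) (\<lambda>i. pairing (e i, 0))"
proof -
  interpret S: vector_space scaleV by (rule vector_space_semidirect_scale)
  show "dual_family scaleV V ({1..n} <+> {1..n})
    (case_sum (\<lambda>i. (e i, 0)) (\<lambda>i. (0, e' i)))
    (case_sum (\<lambda>i. pairing (0, e' i)) (\<lambda>i. pairing (e i, 0)))"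
  proof
    show "S.subspace V" by (rule subspace_semidirect_carrier)
    show "case_sum (\<lambda>i. (e i, 0)) (\<lambda>i. (0, e' i)) i \<in> V" if "i \<in> {1..n} <+> {1..n}" for i
      using that basis_mem by (auto split: sum.split)
    fix X assume "X \<in> V"
    then obtain x a where X: "X = (x, a)" and a: "a \<in> dual_space scale"
      by (auto simp: semidirect_carrier_def)
    have "fst (\<Sum>i\<in>{1..n} <+> {1..n}.
        scaleV (case_sum (\<lambda>i. pairing (0, e' i)) (\<lambda>i. pairing (e i, 0)) i X)
          (case_sum (\<lambda>i. (e i, 0)) (\<lambda>i. (0, e' i)) i)) = x"
      using basis_expansion[of x]
      by (simp add: sum.Plus fst_sum semidirect_scale_def pairing_def X o_def dual_space_simps[OF a])
    moreover have "snd (\<Sum>i\<in>{1..n} <+> {1..n}.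
        scaleV (case_sum (\<lambda>i. pairing (0, e' i)) (\<lambda>i. pairing (e i, 0)) i X)
          (case_sum (\<lambda>i. (e i, 0)) (\<lambda>i. (0, e' i)) i)) v = a v" for v
      using dual_expansion[OF a, of v]
      by (simp add: sum.Plus snd_sum sum_apply semidirect_scale_def pairing_def X o_def)
    ultimately show "X = (\<Sum>i\<in>{1..n} <+> {1..n}.
        scaleV (case_sum (\<lambda>i. pairing (0, e' i)) (\<lambda>i. pairing (e i, 0)) i X)
          (case_sum (\<lambda>i. (e i, 0)) (\<lambda>i. (0, e' i)) i))"
      by (auto simp: X prod_eq_iff fun_eq_iff)
  qed simp
qed

text \<open>The coordinate functionals are themselves pairings with elements of
  \<open>V\<close>.\<close>

lemma tensor2_zero_if_pairings_vanish:
  assumes "Poly_Mapping.keys u \<subseteq> V \<times> V"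
    and "\<And>\<phi> \<psi>. \<phi> \<in> V \<Longrightarrow> \<psi> \<in> V \<Longrightarrow>
      free_eval (\<lambda>(x, y). pairing \<phi> x * pairing \<psi> y) u = 0"
  shows "tensor2_zero scaleV V u"
  using assms(1)
  by (rule S.tensor2_zeroI) (auto simp: assms(2) basis_mem split: sum.split)

lemma tensor3_zero_if_pairings_vanish:
  assumes "Poly_Mapping.keys u \<subseteq> V \<times> V \<times> V"
    and "\<And>\<phi> \<psi> \<chi>. \<phi> \<in> V \<Longrightarrow> \<psi> \<in> V \<Longrightarrow> \<chi> \<in> V \<Longrightarrow>
      free_eval (\<lambda>(x, y, z). pairing \<phi> x * pairing \<psi> y * pairing \<chi> z) u = 0"
  shows "tensor3_zero scaleV V u"
  using assms(1)
  by (rule S.tensor3_zeroI) (auto simp: assms(2) basis_mem split: sum.split)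

lemma keys_r: "Poly_Mapping.keys r \<subseteq> V \<times> V"
proof -
  have "Poly_Mapping.keys (tensor2 (0, e' i) (e i, 0) - tensor2 (e i, 0) (0, e' i) :: _ \<Rightarrow>\<^sub>0 'k)
      \<subseteq> V \<times> V" if "i \<in> {1..n}" for i
    using basis_mem that by (intro order_trans[OF keys_diff]) (auto simp: tensor2_def)
  then show ?thesis
    unfolding r_def by (intro order_trans[OF keys_sum]) blast
qed

lemma free_eval_r:
  "free_eval F r = (\<Sum>i=1..n. F ((0, e' i), (e i, 0)) - F ((e i, 0), (0, e' i)))"
  by (simp add: r_def free_eval_sum free_eval_diff tensor2_def)

lemma reflect_mem: "\<phi> \<in> V \<Longrightarrow> reflect \<phi> \<in> V"
  by (auto simp: reflect_def semidirect_carrier_def dual_space_iff)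

text \<open>This is \<open>L\<close> applied to the basis expansion of
  \<open>reflect \<phi>\<close>, whose coordinates agree with the pairings of \<open>\<phi>\<close>
  on the \<open>e' i\<close> and are opposite to those on the \<open>e i\<close>. The right side is
  \<open>r\<close> contracted with \<open>\<phi>\<close> on its first leg.\<close>

lemma functional_reflect:
  assumes L: "functional_on scaleV V L" and \<phi>: "\<phi> \<in> V"
  shows "L (reflect \<phi>) = (\<Sum>i=1..n. pairing \<phi> (0, e' i) * L (e i, 0) - pairing \<phi> (e i, 0) * L (0, e' i))"
proof -
  have a: "snd \<phi> \<in> dual_space scale" using \<phi> by (auto simp: semidirect_carrier_def)
  show ?thesis
    using S.functional_expansion[OF L reflect_mem[OF \<phi>]]
    by (simp add: sum.Plus o_def pairing_def reflect_def dual_space_simps[OF a] sum_negf sum_subtractf)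
qed

lemma contract_left:
  "functional_on scaleV V L \<Longrightarrow> \<phi> \<in> V \<Longrightarrow>
    free_eval (\<lambda>(x, y). pairing \<phi> x * L y) r = L (reflect \<phi>)"
  by (simp add: functional_reflect free_eval_r)

lemma contract_right:
  "functional_on scaleV V L \<Longrightarrow> \<phi> \<in> V \<Longrightarrow>
    free_eval (\<lambda>(x, y). L x * pairing \<phi> y) r = - L (reflect \<phi>)"
  by (simp add: functional_reflect free_eval_r algebra_simps flip: sum_negf)

lemma antisymmetric_r: "antisymmetric_tensor scaleV V r"
  unfolding antisymmetric_tensor_def
proof (rule tensor2_zero_if_pairings_vanish)
  have "Poly_Mapping.keys (flip r) \<subseteq> V \<times> V"
    unfolding flip_def using keys_r
    by (intro order_trans[OF keys_free_extend]) (auto simp: tensor2_def)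
  then show "Poly_Mapping.keys (flip r - - r) \<subseteq> V \<times> V"
    using keys_r keys_add[of "flip r" r] by auto
  fix \<phi> \<psi> assume \<phi>: "\<phi> \<in> V" and \<psi>: "\<psi> \<in> V"
  have "free_eval (\<lambda>(x, y). pairing \<phi> x * pairing \<psi> y) (flip r)
      = free_eval (\<lambda>(x, y). pairing \<psi> x * pairing \<phi> y) r"
    by (simp add: flip_def free_eval_free_extend case_prod_unfold tensor2_def mult.commute)
  \<comment> \<open>The two contractions cancel because \<open>reflect\<close> is skew for the
    form.\<close>
  then show "free_eval (\<lambda>(x, y). pairing \<phi> x * pairing \<psi> y) (flip r - - r) = 0"
    using contract_left[OF functional_on_pairing] \<phi> \<psi>
    by (simp add: free_eval_add pairing_def reflect_def)
qed

section \<open>Linear maps acting on one leg of the tensor\<close>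

lemma keys_tensor_map:
  assumes "linear_on scaleV V f" "linear_on scaleV V g"
  shows "Poly_Mapping.keys (tensor_map f g r) \<subseteq> V \<times> V"
  unfolding tensor_map_def using keys_r assms
  by (intro order_trans[OF keys_free_extend]) (auto simp: tensor2_def linear_on_def)

lemma linear_on_id: "linear_on scaleV V id"
  by (simp add: linear_on_def)

text \<open>Contracting on the leg left untouched gives
  \<open>- pairing \<phi> (f (reflect \<psi>))\<close> for the first tensor and
  \<open>pairing \<psi> (g (reflect \<phi>))\<close> for the second.\<close>

lemma tensor_map_r_zero:
  assumes f: "linear_on scaleV V f" and g: "linear_on scaleV V g"
    and adjoint: "\<And>\<phi> \<psi>. \<phi> \<in> V \<Longrightarrow> \<psi> \<in> V \<Longrightarrow>
      pairing \<phi> (f (reflect \<psi>)) + pairing \<psi> (g (reflect \<phi>)) = 0"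
  shows "tensor2_zero scaleV V (tensor_map f id r - tensor_map id g r)"
proof (rule tensor2_zero_if_pairings_vanish)
  show "Poly_Mapping.keys (tensor_map f id r - tensor_map id g r) \<subseteq> V \<times> V"
    by (intro order_trans[OF keys_diff] Un_least keys_tensor_map f g linear_on_id)
  fix \<phi> \<psi> assume \<phi>: "\<phi> \<in> V" and \<psi>: "\<psi> \<in> V"
  have "free_eval (\<lambda>(x, y). pairing \<phi> x * pairing \<psi> y) (tensor_map f id r)
      = free_eval (\<lambda>(x, y). pairing \<phi> (f x) * pairing \<psi> y) r"
    by (simp add: tensor_map_def free_eval_free_extend case_prod_unfold tensor2_def)
  also have "\<dots> = - pairing \<phi> (f (reflect \<psi>))"
    by (rule contract_right[OF functional_on_linear[OF functional_on_pairing[OF \<phi>] f] \<psi>])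
  also have "\<dots> = pairing \<psi> (g (reflect \<phi>))"
    using adjoint[OF \<phi> \<psi>] by (simp add: eq_neg_iff_add_eq_0 add.commute neg_eq_iff_add_eq_0)
  also have "\<dots> = free_eval (\<lambda>(x, y). pairing \<phi> x * pairing \<psi> (g y)) r"
    by (rule contract_left[OF functional_on_linear[OF functional_on_pairing[OF \<psi>] g] \<phi>, symmetric])
  also have "\<dots> = free_eval (\<lambda>(x, y). pairing \<phi> x * pairing \<psi> y) (tensor_map id g r)"
    by (simp add: tensor_map_def free_eval_free_extend case_prod_unfold tensor2_def)
  finally show "free_eval (\<lambda>(x, y). pairing \<phi> x * pairing \<psi> y) (tensor_map f id r - tensor_map id g r) = 0"
    by (simp add: free_eval_diff)
qed

section \<open>Double contractions against a bilinear operation\<close>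

context
  fixes m :: "'a \<times> ('a \<Rightarrow> 'k) \<Rightarrow> 'a \<times> ('a \<Rightarrow> 'k) \<Rightarrow> 'a \<times> ('a \<Rightarrow> 'k)" and \<phi> \<psi> \<chi>
  assumes m: "bilinear_on scaleV V m" and mem: "\<phi> \<in> V" "\<psi> \<in> V" "\<chi> \<in> V"
begin

private lemma functional_on_mult:
  assumes "\<theta> \<in> V" "x \<in> V"
  shows "functional_on scaleV V (\<lambda>y. pairing \<theta> (m x y))"
    "functional_on scaleV V (\<lambda>y. pairing \<theta> (m y x))"
  using functional_on_linear[OF functional_on_pairing[OF assms(1)]] m assms(2)
  by (auto simp: bilinear_on_def)

text \<open>Both copies of \<open>r\<close> are contracted on their second legs, so the two signs
  cancel.\<close>

lemma contract_first_slot: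
  "free_eval (\<lambda>(x, y). free_eval (\<lambda>(x', y').
      pairing \<phi> (m x x') * pairing \<psi> y * pairing \<chi> y') r) r
    = pairing \<phi> (m (reflect \<psi>) (reflect \<chi>))"
proof -
  \<comment> \<open>The inner copy is contracted first, with a generator of the outer copy fixed;
    its first leg lies in \<open>V\<close>, so multiplication by it is linear on
    \<open>V\<close>.\<close>
  have "free_eval (\<lambda>(x, y). free_eval (\<lambda>(x', y').
      pairing \<phi> (m x x') * pairing \<psi> y * pairing \<chi> y') r) r
    = free_eval (\<lambda>(x, y). (- 1) * (pairing \<phi> (m x (reflect \<chi>)) * pairing \<psi> y)) r"
  proof (rule free_eval_cong, clarify)
    fix x a y b assume "((x, a), (y, b)) \<in> Poly_Mapping.keys r"
    then have x: "(x, a) \<in> V" using keys_r by auto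
    have "free_eval (\<lambda>(x', y'). pairing \<phi> (m (x, a) x') * pairing \<psi> (y, b) * pairing \<chi> y') r
        = pairing \<psi> (y, b) * free_eval (\<lambda>(x', y'). pairing \<phi> (m (x, a) x') * pairing \<chi> y') r"
      unfolding free_eval_fun_cmult[symmetric] by (rule free_eval_cong) (auto simp: mult_ac)
    then show "free_eval (\<lambda>(x', y'). pairing \<phi> (m (x, a) x') * pairing \<psi> (y, b) * pairing \<chi> y') r
        = (- 1) * (pairing \<phi> (m (x, a) (reflect \<chi>)) * pairing \<psi> (y, b))"
      using contract_right[OF functional_on_mult(1)[OF mem(1) x] mem(3)] by simp
  qed
  also have "\<dots> = (- 1) * free_eval (\<lambda>(x, y). pairing \<phi> (m x (reflect \<chi>)) * pairing \<psi> y) r"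
    unfolding free_eval_fun_cmult[symmetric] by (rule free_eval_cong) auto
  finally show ?thesis
    using contract_right[OF functional_on_mult(2)[OF mem(1) reflect_mem[OF mem(3)]] mem(2)] by simp
qed

text \<open>One copy is contracted on its first leg and the other on its second, which leaves one
  sign.\<close>

lemma contract_second_slot:
  "free_eval (\<lambda>(x, y). free_eval (\<lambda>(x', y').
      pairing \<phi> x * pairing \<psi> (m y x') * pairing \<chi> y') r) r
    = - pairing \<psi> (m (reflect \<phi>) (reflect \<chi>))"
proof -
  have "free_eval (\<lambda>(x, y). free_eval (\<lambda>(x', y').
      pairing \<phi> x * pairing \<psi> (m y x') * pairing \<chi> y') r) r
    = free_eval (\<lambda>(x, y). (- 1) * (pairing \<phi> x * pairing \<psi> (m y (reflect \<chi>)))) r"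
  proof (rule free_eval_cong, clarify)
    fix x a y b assume "((x, a), (y, b)) \<in> Poly_Mapping.keys r"
    then have y: "(y, b) \<in> V" using keys_r by auto
    have "free_eval (\<lambda>(x', y'). pairing \<phi> (x, a) * pairing \<psi> (m (y, b) x') * pairing \<chi> y') r
        = pairing \<phi> (x, a) * free_eval (\<lambda>(x', y'). pairing \<psi> (m (y, b) x') * pairing \<chi> y') r"
      unfolding free_eval_fun_cmult[symmetric] by (rule free_eval_cong) (auto simp: mult_ac)
    then show "free_eval (\<lambda>(x', y'). pairing \<phi> (x, a) * pairing \<psi> (m (y, b) x') * pairing \<chi> y') r
        = (- 1) * (pairing \<phi> (x, a) * pairing \<psi> (m (y, b) (reflect \<chi>)))"
      using contract_right[OF functional_on_mult(1)[OF mem(2) y] mem(3)] by simp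
  qed
  also have "\<dots> = (- 1) * free_eval (\<lambda>(x, y). pairing \<phi> x * pairing \<psi> (m y (reflect \<chi>))) r"
    unfolding free_eval_fun_cmult[symmetric] by (rule free_eval_cong) auto
  finally show ?thesis
    using contract_left[OF functional_on_mult(2)[OF mem(2) reflect_mem[OF mem(3)]] mem(1)] by simp
qed

text \<open>Both contractions are on first legs, so no sign appears.\<close>

lemma contract_third_slot:
  "free_eval (\<lambda>(x, y). free_eval (\<lambda>(x', y').
      pairing \<phi> x * pairing \<psi> x' * pairing \<chi> (m y y')) r) r
    = pairing \<chi> (m (reflect \<phi>) (reflect \<psi>))"
proof -
  have "free_eval (\<lambda>(x, y). free_eval (\<lambda>(x', y').
      pairing \<phi> x * pairing \<psi> x' * pairing \<chi> (m y y')) r) r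
    = free_eval (\<lambda>(x, y). pairing \<phi> x * pairing \<chi> (m y (reflect \<psi>))) r"
  proof (rule free_eval_cong, clarify)
    fix x a y b assume "((x, a), (y, b)) \<in> Poly_Mapping.keys r"
    then have y: "(y, b) \<in> V" using keys_r by auto
    have "free_eval (\<lambda>(x', y'). pairing \<phi> (x, a) * pairing \<psi> x' * pairing \<chi> (m (y, b) y')) r
        = pairing \<phi> (x, a) * free_eval (\<lambda>(x', y'). pairing \<psi> x' * pairing \<chi> (m (y, b) y')) r"
      unfolding free_eval_fun_cmult[symmetric] by (rule free_eval_cong) (auto simp: mult_ac)
    then show "free_eval (\<lambda>(x', y'). pairing \<phi> (x, a) * pairing \<psi> x' * pairing \<chi> (m (y, b) y')) r
        = pairing \<phi> (x, a) * pairing \<chi> (m (y, b) (reflect \<psi>))"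
      using contract_left[OF functional_on_mult(1)[OF mem(3) y] mem(2)] by simp
  qed
  then show ?thesis
    using contract_left[OF functional_on_mult(2)[OF mem(3) reflect_mem[OF mem(2)]] mem(1)] by simp
qed

end

section \<open>The Yang-Baxter expressions of the canonical tensor\<close>

lemma bilinear_on_mem: "bilinear_on scaleV V m \<Longrightarrow> x \<in> V \<Longrightarrow> y \<in> V \<Longrightarrow> m x y \<in> V"
  by (simp add: bilinear_on_def linear_on_def)

lemma bilinear_on_swap: "bilinear_on scaleV V m \<Longrightarrow> bilinear_on scaleV V (\<lambda>x y. m y x)"
  by (simp add: bilinear_on_def)

lemma bilinear_on_commutator:
  assumes "bilinear_on scaleV V m"
  shows "bilinear_on scaleV V (commutator m)"
  using assms S.subspace_diff[OF S.subspace]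
  by (auto simp: bilinear_on_def linear_on_def commutator_def algebra_simps S.scale_right_diff_distrib)

lemma keys_YBE:
  assumes "\<And>a b a' b'. a \<in> V \<Longrightarrow> b \<in> V \<Longrightarrow> a' \<in> V \<Longrightarrow> b' \<in> V \<Longrightarrow>
    Poly_Mapping.keys (t a b a' b' :: _ \<Rightarrow>\<^sub>0 'k) \<subseteq> V \<times> V \<times> V"
  shows "Poly_Mapping.keys (free_extend (\<lambda>(a, b). free_extend (\<lambda>(a', b'). t a b a' b') r) r)
    \<subseteq> V \<times> V \<times> V"
proof -
  have "Poly_Mapping.keys (free_extend (\<lambda>(a', b'). t a b a' b') r) \<subseteq> V \<times> V \<times> V"
    if "a \<in> V" "b \<in> V" for a b
    using that keys_r assms by (intro order_trans[OF keys_free_extend]) fast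
  then show ?thesis
    using keys_r by (intro order_trans[OF keys_free_extend]) fast
qed

lemma keys_tensor3: "x \<in> V \<Longrightarrow> y \<in> V \<Longrightarrow> z \<in> V \<Longrightarrow>
    Poly_Mapping.keys (tensor3 x y z :: _ \<Rightarrow>\<^sub>0 'k) \<subseteq> V \<times> V \<times> V"
  by (simp add: tensor3_def)

lemma YBE_A_r_zero:
  assumes m: "bilinear_on scaleV V m"
    and cyclic: "\<And>\<phi> \<psi> \<chi>. \<phi> \<in> V \<Longrightarrow> \<psi> \<in> V \<Longrightarrow> \<chi> \<in> V \<Longrightarrow>
      pairing \<phi> (m (reflect \<psi>) (reflect \<chi>)) + pairing \<psi> (m (reflect \<chi>) (reflect \<phi>))
        + pairing \<chi> (m (reflect \<phi>) (reflect \<psi>)) = 0"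
  shows "tensor3_zero scaleV V (YBE_A m r)"
proof (rule tensor3_zero_if_pairings_vanish)
  show "Poly_Mapping.keys (YBE_A m r) \<subseteq> V \<times> V \<times> V"
    unfolding YBE_A_def
    by (intro keys_YBE order_trans[OF keys_add] order_trans[OF keys_diff] Un_least keys_tensor3
        bilinear_on_mem[OF m])
  fix \<phi> \<psi> \<chi> assume mem: "\<phi> \<in> V" "\<psi> \<in> V" "\<chi> \<in> V"
  show "free_eval (\<lambda>(x, y, z). pairing \<phi> x * pairing \<psi> y * pairing \<chi> z) (YBE_A m r) = 0"
    \<comment> \<open>The middle term multiplies in the order \<open>m a' b\<close>, hence the
      swapped operation; its sign in the equation cancels the sign of the contraction.\<close>
    using contract_first_slot[OF m mem] contract_second_slot[OF bilinear_on_swap[OF m] mem]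
      contract_third_slot[OF m mem] cyclic[OF mem]
    by (simp add: YBE_A_def free_eval_free_extend case_prod_unfold free_eval_add free_eval_diff
        free_eval_fun_add free_eval_fun_diff tensor3_def)
qed

lemma YBE_T_r_zero:
  assumes m: "bilinear_on scaleV V m"
    and cyclic: "\<And>\<phi> \<psi> \<chi>. \<phi> \<in> V \<Longrightarrow> \<psi> \<in> V \<Longrightarrow> \<chi> \<in> V \<Longrightarrow>
      pairing \<phi> (m (reflect \<psi>) (reflect \<chi>)) - pairing \<psi> (m (reflect \<phi>) (reflect \<chi>))
        - pairing \<chi> (commutator m (reflect \<phi>) (reflect \<psi>)) = 0"
  shows "tensor3_zero scaleV V (YBE_T m r)"
proof (rule tensor3_zero_if_pairings_vanish)
  show "Poly_Mapping.keys (YBE_T m r) \<subseteq> V \<times> V \<times> V"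
    unfolding YBE_T_def
    by (intro keys_YBE order_trans[OF keys_add] order_trans[OF keys_diff] Un_least keys_tensor3
        bilinear_on_mem[OF m] bilinear_on_mem[OF bilinear_on_commutator[OF m]])
  fix \<phi> \<psi> \<chi> assume mem: "\<phi> \<in> V" "\<psi> \<in> V" "\<chi> \<in> V"
  show "free_eval (\<lambda>(x, y, z). pairing \<phi> x * pairing \<psi> y * pairing \<chi> z) (YBE_T m r) = 0"
    using contract_first_slot[OF m mem] contract_second_slot[OF m mem]
      contract_third_slot[OF bilinear_on_commutator[OF m] mem] cyclic[OF mem]
    by (simp add: YBE_T_def free_eval_free_extend case_prod_unfold free_eval_add free_eval_diff
        free_eval_fun_add free_eval_fun_diff tensor3_def)
qed

end

section \<open>The algebra together with a basis\<close>

locale relative_pre_PCA_dual_basis = relative_pre_PCA_algebra + D: dual_basis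
begin

theorem relative_PCA_semidirect: "relative_PCA_algebra scaleV V dotV circV PV QV"
proof (intro relative_PCA_algebra.intro PCA_operations.intro PCA_operations_axioms.intro
    relative_PCA_algebra_axioms.intro)
  show "vector_space scaleV" by (rule vector_space_semidirect_scale)
  show "D.S.subspace V" by (rule subspace_semidirect_carrier)
  show "\<exists>B. finite B \<and> D.S.span B = V" using D.S.span_eq D.S.finite by blast
  show "bilinear_on scaleV V dotV" by (rule dotV_bilinear)
  show "bilinear_on scaleV V circV" by (rule circV_bilinear)
  show "linear_on scaleV V PV" by (rule PV_linear)
  show "linear_on scaleV V QV" by (rule QV_linear)
  show "dotV X Y = dotV Y X" for X Y
    by (cases X; cases Y) (simp add: dotV_pair sub_dot_def add.commute)
qed (simp only: split_paired_all V_pair, (rule dotV_assoc circV_anti_pre_lie_1 circV_anti_pre_lie_2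
    PV_dotV PV_bracketV bracketV_dotV QV_dotV QV_circV circV_dotV dotV_circV; assumption))+

theorem RPCA_YBE_solution_r: "RPCA_YBE_solution scaleV V dotV circV PV QV D.r"
  unfolding RPCA_YBE_solution_def
proof (intro conjI D.keys_r D.YBE_A_r_zero D.YBE_T_r_zero D.tensor_map_r_zero dotV_bilinear circV_bilinear
    PV_linear QV_linear)
  fix \<phi> \<psi> \<chi> assume "\<phi> \<in> V" "\<psi> \<in> V" "\<chi> \<in> V"
  then obtain x a y b z c where *: "\<phi> = (x, a)" "\<psi> = (y, b)" "\<chi> = (z, c)"
    and dual: "a \<in> dual_space scale" "b \<in> dual_space scale" "c \<in> dual_space scale"
    by (auto simp: semidirect_carrier_def)
  note simps = * pairing_def reflect_def dotV_pair circV_pair bracketV_pair expand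
    dual_space_simps[OF dual(1)] dual_space_simps[OF dual(2)] dual_space_simps[OF dual(3)]
  \<comment> \<open>The coefficient of \<open>a\<close> is
    \<open>y \<cdot> z - z \<star> y - y \<star> z\<close>; those of \<open>b\<close> and
    \<open>c\<close> follow cyclically.\<close>
  show "pairing \<phi> (dotV (reflect \<psi>) (reflect \<chi>)) + pairing \<psi> (dotV (reflect \<chi>) (reflect \<phi>))
      + pairing \<chi> (dotV (reflect \<phi>) (reflect \<psi>)) = 0"
    by (simp add: simps)
  \<comment> \<open>The coefficient of \<open>a\<close> is
    \<open>y \<odot> z - y \<prec> z - y \<succ> z\<close>, that of \<open>b\<close> is opposite in
    sign with \<open>x\<close> for \<open>y\<close>, and \<open>c\<close> sees the expanded bracket
    of \<open>x\<close> and \<open>y\<close> minus itself.\<close>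
  show "pairing \<phi> (circV (reflect \<psi>) (reflect \<chi>)) - pairing \<psi> (circV (reflect \<phi>) (reflect \<chi>))
      - pairing \<chi> (commutator circV (reflect \<phi>) (reflect \<psi>)) = 0"
    by (simp add: simps)
next
  fix \<phi> \<psi> assume "\<phi> \<in> V" "\<psi> \<in> V"
  \<comment> \<open>\<open>PV\<close> and \<open>QV\<close> are adjoint for the form and commute
    with \<open>reflect\<close>, which is skew.\<close>
  show "pairing \<phi> (QV (reflect \<psi>)) + pairing \<psi> (PV (reflect \<phi>)) = 0"
    "pairing \<phi> (PV (reflect \<psi>)) + pairing \<psi> (QV (reflect \<phi>)) = 0"
    by (simp_all add: pairing_def reflect_def transpose_map_def)
qed

end

section \<open>The result for a basis and its dual basis\<close>

theorem proposition4p19: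
  fixes scale :: "'k::{alg_closed_field, field_char_0} \<Rightarrow> 'a::ab_group_add \<Rightarrow> 'a"
    and star succ prec :: "'a \<Rightarrow> 'a \<Rightarrow> 'a"
    and P Q :: "'a \<Rightarrow> 'a"
    and n :: nat
    and e :: "nat \<Rightarrow> 'a"
    and e' :: "nat \<Rightarrow> 'a \<Rightarrow> 'k"
  assumes pre_PCA: "relative_pre_PCA_algebra scale star succ prec P Q"
    and basis: "finite_dimensional_vector_space scale (e ` {1..n})" "inj_on e {1..n}"
    and dual_basis: "\<And>i. i \<in> {1..n} \<Longrightarrow> e' i \<in> dual_space scale"
      "\<And>i j. i \<in> {1..n} \<Longrightarrow> j \<in> {1..n} \<Longrightarrow> e' i (e j) = (if i = j then 1 else 0)"
  shows
    "let scaleV = semidirect_scale scale;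
         V = semidirect_carrier scale;
         dotV = semidirect_dot (sub_dot star) (- dual_rep (left_mult star));
         circV = semidirect_circ (sub_circ succ prec)
                   (dual_rep (right_mult prec) - dual_rep (left_mult succ))
                   (dual_rep (right_mult prec));
         PV = map_prod P (transpose_map Q);
         QV = map_prod Q (transpose_map P);
         r = (\<Sum>i=1..n. tensor2 (0, e' i) (e i, 0) - tensor2 (e i, 0) (0, e' i))
     in relative_PCA_algebra scaleV V dotV circV PV QV \<and>
        antisymmetric_tensor scaleV V r \<and>
        RPCA_YBE_solution scaleV V dotV circV PV QV r"
proof -
  interpret relative_pre_PCA_algebra scale star succ prec P Q by (fact pre_PCA)
  interpret B: finite_dimensional_vector_space scale "e ` {1..n}" by (fact basis)
  have expansion: "x = (\<Sum>i=1..n. scale (e' i x) (e i))" for x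
  proof -
    have "x \<in> span (e ` {1..n})" using B.span_Basis by blast
    then show ?thesis
    proof (induction rule: span_induct_alt)
      case base
      show ?case using dual_basis(1) by (simp add: dual_space_simps)
    next
      case (step c v x)
      then obtain j where j: "j \<in> {1..n}" "v = e j" by auto
      \<comment> \<open>By the Kronecker relations, adding a multiple \<open>c\<close> of
        \<open>e j\<close> changes only the coordinate at \<open>j\<close>, by
        \<open>c\<close>.\<close>
      have "(\<Sum>i=1..n. scale (e' i (scale c v + x)) (e i))
          = (\<Sum>i=1..n. if i = j then scale c (e j) else 0) + (\<Sum>i=1..n. scale (e' i x) (e i))"
        unfolding sum.distrib[symmetric] using j dual_basis
        by (intro sum.cong) (auto simp: dual_space_simps scale_left_distrib)
      also have "\<dots> = scale c v + x" using j step by simp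
      finally show ?case by simp
    qed
  qed
  interpret D: dual_basis scale n e e'
    by unfold_locales (fact dual_basis(1), fact expansion)
  interpret relative_pre_PCA_dual_basis scale star succ prec P Q n e e' ..
  show ?thesis
    unfolding Let_def
    using relative_PCA_semidirect D.antisymmetric_r RPCA_YBE_solution_r by (simp add: D.r_def)
qed

end
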